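(* Let $d,k\ge1$, let $\mathbf{\Lambda}_j=(\lambda_{j1},\dots,\lambda_{jd})\succ\mathbf{0}$, $j=1,\dots,k$, let $\boldsymbol{\alpha}=(\alpha_1,\dots,\alpha_d)$ with $\alpha_i\in(0,1)$, let $\{\mathscr{M}(\mathbf{t})\}_{\mathbf{t}\in\mathbb{R}^d_+}$ be a multiparameter GCP with transition parameters $\mathbf{\Lambda}_j$, $j=1,\dots,k$, and let $\boldsymbol{\mathscr{D}}^{\boldsymbol{\alpha}}(\mathbf{t})=(D_1^{\alpha_1}(t_1),\dots,D_d^{\alpha_d}(t_d))$, $\mathbf{t}\in\mathbb{R}^d_+$, be a multiparameter stable subordinator independent of $\{\mathscr{M}(\mathbf{t})\}$. Set $\mathscr{M}^{\boldsymbol{\alpha}}(\mathbf{t})=\mathscr{M}(\boldsymbol{\mathscr{D}}^{\boldsymbol{\alpha}}(\mathbf{t}))$. Then the distribution $p^{\boldsymbol{\alpha}}(n,\mathbf{t})=\mathrm{Pr}\{\mathscr{M}^{\boldsymbol{\alpha}}(\mathbf{t})=n\}$, $n\ge0$, is given by $$p^{\boldsymbol{\alpha}}(n,\mathbf{t})=\sum_{\Theta(n,d)}\prod_{i=1}^{d}\sum_{\Omega(k,n_i)}\Big(\prod_{j=1}^{k}\Big(-\frac{\lambda_{ji}}{\mu_i}\Big)^{n_{ji}}\frac{1}{n_{ji}!}\Big)\sum_{r_i=0}^{\infty}\frac{(-\mu_{i}^{\alpha_i}t_i)^{r_i}\,\Gamma(\alpha_ir_i+1)}{r_i!\,\Gamma(\alpha_ir_i+1-\sum_{j=1}^{k}n_{ji})},$$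 where $\mu_i=\lambda_{1i}+\lambda_{2i}+\dots+\lambda_{ki}$, $\Theta(n,d)=\{(n_1,\dots,n_d):\sum_{i=1}^{d}n_i=n,\ n_i\in\mathbb{N}_0\}$ and $\Omega(k,n_i)=\{(n_{1i},\dots,n_{ki}):\sum_{j=1}^{k}jn_{ji}=n_i,\ n_{ji}\in\mathbb{N}_0\}$. Also, for any $i=1,2,\dots,d$, it solves the system of differential equations $$\frac{\partial}{\partial t_i}p^{\boldsymbol{\alpha}}(n,\mathbf{t})=-\Big(\sum_{j=1}^{k}\lambda_{ji}(I-B^j)\Big)^{\alpha_i}p^{\boldsymbol{\alpha}}(n,\mathbf{t}),\quad n\ge0,$$ with initial conditions $p^{\boldsymbol{\alpha}}(0,\mathbf{0})=1$ and $p^{\boldsymbol{\alpha}}(n,\mathbf{0})=0$, $n\ge1$.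
   Context: $\mathbb{R}_+=[0,\infty)$, $\mathbb{N}_0=\{0,1,2,\dots\}$, $\mathbf{t}\cdot\mathbf{s}=\sum_{i=1}^d t_is_i$; $\mathbf{s}\preceq\mathbf{t}$ means $s_i\le t_i$ for all $i$, and $\mathbf{s}\prec\mathbf{t}$ means $s_i<t_i$ for all $i$. $\overset{d}{=}$ denotes equality in distribution. $1/\Gamma$ is understood to be $0$ at non-positive integers. An integer-valued random process $\{\mathcal{N}(\mathbf{t})\}_{\mathbf{t}\in\mathbb{R}^d_+}$ is a multiparameter counting process if $\mathcal{N}(\mathbf{0})=0$, $\mathcal{N}(\mathbf{t})\ge0$ for all $\mathbf{t}$, and $\mathcal{N}(\mathbf{s})\le\mathcal{N}(\mathbf{t})$ whenever $\mathbf{s}\preceq\mathbf{t}$. A multiparameter counting process $\{\mathscr{M}(\mathbf{t})\}_{\mathbf{t}\in\mathbb{R}^d_+}$ is a multiparameter GCP (generalized counting process) with transition parameters $\mathbf{\Lambda}_j\succ\mathbf{0}$, $j=1,\dots,k$, if: (i) $\mathscr{M}(\mathbf{0})=0$; (ii) whenever $\mathbf{0}=\mathbf{t}^{(0)}\prec\mathbf{t}^{(1)}\prec\dots\prec\mathbf{t}^{(n)}$, the increments $\mathscr{M}(\mathbf{t}^{(1)})-\mathscr{M}(\mathbf{t}^{(0)}),\dots,\mathscr{M}(\mathbf{t}^{(n)})-\mathscr{M}(\mathbf{t}^{(n-1)})$ are mutually independent; (iii) $\mathscr{M}(\mathbf{t})-\mathscr{M}(\mathbf{s})\overset{d}{=}\mathscr{M}(\mathbf{t}-\mathbf{s})$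 whenever $\mathbf{s}\preceq\mathbf{t}$; (iv) $\mathrm{Pr}(\mathscr{M}(\mathbf{t})=n)=\sum_{(x_1,\dots,x_k)\in\mathbb{N}_0^k:\ \sum_j jx_j=n}\ \prod_{j=1}^{k}\frac{(\mathbf{\Lambda}_j\cdot\mathbf{t})^{x_j}}{x_j!}e^{-\mathbf{\Lambda}_j\cdot\mathbf{t}}$ for $n\ge0$. For $\alpha\in(0,1)$, an $\alpha$-stable subordinator $\{D^{\alpha}(t)\}_{t\ge0}$ is a subordinator (non-decreasing Lévy process) with $\mathbb{E}e^{-wD^\alpha(t)}=e^{-tw^\alpha}$, $w>0$. A multiparameter stable subordinator is $\boldsymbol{\mathscr{D}}^{\boldsymbol{\alpha}}(\mathbf{t})=(D_1^{\alpha_1}(t_1),\dots,D_d^{\alpha_d}(t_d))$ where the $\{D_i^{\alpha_i}(t)\}_{t\ge0}$ are independent $\alpha_i$-stable subordinators. $I$ is the identity and $B$ is the backward shift operator in $n$: $Bp^{\boldsymbol{\alpha}}(n,\mathbf{t})=p^{\boldsymbol{\alpha}}(n-1,\mathbf{t})$, with $p^{\boldsymbol{\alpha}}(m,\mathbf{t})=0$ for $m<0$. The fractional power of the operator is defined by the binomial expansion $$\Big(\sum_{j=1}^{k}\lambda_{ji}(I-B^j)\Big)^{\alpha_i}=\mu_i^{\alpha_i}\sum_{r=0}^{\infty}\binom{\alpha_i}{r}\Big(-\frac{1}{\mu_i}\Big)^{r}\Big(\sum_{j=1}^{k}\lambda_{ji}B^j\Big)^{r},$$ which is a finite sum when applied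 to $p^{\boldsymbol{\alpha}}(n,\mathbf{t})$ for fixed $n$. *)

theory Defs
  imports "HOL-Probability.Probability"
begin

text \<open>
  \<open>\<real>\<^sup>d\<^sub>+\<close> is the set \<open>{0..}\<close> in \<open>real ^ 'd\<close>, whose library order \<open>\<le>\<close> is componentwise.  The strict
  order of the library is only \<open>s \<le> t \<and> s \<noteq> t\<close>, hence the separate relation below.  Processes are
  total functions; their values at indices outside \<open>{0..}\<close> are irrelevant.
\<close>

definition prec :: "real ^ 'd \<Rightarrow> real ^ 'd \<Rightarrow> bool" (infix "\<prec>" 50) where
  "s \<prec> t \<longleftrightarrow> (\<forall>i. s $ i < t $ i)"

text \<open>
  \<open>Omega k n\<close> is the set of solutions in \<open>\<nat>\<^sub>0\<close> of \<open>1 x\<^sub>1 + \<dots> + k x\<^sub>k = n\<close>; extensionality outside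
  \<open>{1..k}\<close> makes each solution a single function.
\<close>

definition Omega :: "nat \<Rightarrow> nat \<Rightarrow> (nat \<Rightarrow> nat) set" where
  "Omega k n = {x \<in> {1..k} \<rightarrow>\<^sub>E UNIV. (\<Sum>j=1..k. j * x j) = n}"

definition Theta :: "nat \<Rightarrow> ('d::finite \<Rightarrow> nat) set" where
  "Theta n = {m. (\<Sum>i\<in>UNIV. m i) = n}"

context prob_space
begin

definition multi_counting_process :: "(real ^ 'd \<Rightarrow> 'a \<Rightarrow> int) \<Rightarrow> bool" where
  "multi_counting_process N \<longleftrightarrow>
     (\<forall>t\<ge>0. random_variable (count_space UNIV) (N t)) \<and>
     (\<forall>\<omega>\<in>space M. N 0 \<omega> = 0 \<and> (\<forall>t\<ge>0. N t \<omega> \<ge> 0) \<and>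
        (\<forall>s t. 0 \<le> s \<longrightarrow> s \<le> t \<longrightarrow> N s \<omega> \<le> N t \<omega>))"

definition multi_GCP :: "nat \<Rightarrow> (nat \<Rightarrow> real ^ 'd) \<Rightarrow> (real ^ 'd \<Rightarrow> 'a \<Rightarrow> int) \<Rightarrow> bool" where
  "multi_GCP k \<Lambda> N \<longleftrightarrow>
     multi_counting_process N \<and>
     (\<forall>\<omega>\<in>space M. N 0 \<omega> = 0) \<and>
     (\<forall>n \<tau>. \<tau> 0 = 0 \<longrightarrow> (\<forall>m<n. \<tau> m \<prec> \<tau> (Suc m)) \<longrightarrow>
        indep_vars (\<lambda>_. count_space UNIV) (\<lambda>m \<omega>. N (\<tau> (Suc m)) \<omega> - N (\<tau> m) \<omega>) {..<n}) \<and>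
     (\<forall>s t. 0 \<le> s \<longrightarrow> s \<le> t \<longrightarrow>
        distr M (count_space UNIV) (\<lambda>\<omega>. N t \<omega> - N s \<omega>) = distr M (count_space UNIV) (N (t - s))) \<and>
     (\<forall>t\<ge>0. \<forall>n::nat. prob {\<omega> \<in> space M. N t \<omega> = int n} =
        (\<Sum>x\<in>Omega k n. \<Prod>j=1..k. (\<Lambda> j \<bullet> t) ^ x j / fact (x j) * exp (- (\<Lambda> j \<bullet> t))))"

text \<open>Levy processes in law: no path regularity beyond stochastic continuity is required.\<close>

definition levy_process :: "(real \<Rightarrow> 'a \<Rightarrow> real) \<Rightarrow> bool" where
  "levy_process X \<longleftrightarrow>
     (\<forall>t\<ge>0. random_variable borel (X t)) \<and>
     (AE \<omega> in M. X 0 \<omega> = 0) \<and>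
     (\<forall>n \<tau>. 0 \<le> \<tau> 0 \<longrightarrow> (\<forall>m<n. \<tau> m < \<tau> (Suc m)) \<longrightarrow>
        indep_vars (\<lambda>_. borel) (\<lambda>m \<omega>. X (\<tau> (Suc m)) \<omega> - X (\<tau> m) \<omega>) {..<n::nat}) \<and>
     (\<forall>s t. 0 \<le> s \<longrightarrow> s \<le> t \<longrightarrow>
        distr M borel (\<lambda>\<omega>. X t \<omega> - X s \<omega>) = distr M borel (X (t - s))) \<and>
     (\<forall>s\<ge>0. \<forall>\<epsilon>>0.
        ((\<lambda>t. prob {\<omega> \<in> space M. \<bar>X t \<omega> - X s \<omega>\<bar> > \<epsilon>}) \<longlongrightarrow> 0) (at s within {0..}))"

definition subordinator :: "(real \<Rightarrow> 'a \<Rightarrow> real) \<Rightarrow> bool" where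
  "subordinator X \<longleftrightarrow>
     levy_process X \<and> (AE \<omega> in M. \<forall>s t. 0 \<le> s \<longrightarrow> s \<le> t \<longrightarrow> X s \<omega> \<le> X t \<omega>)"

definition stable_subordinator :: "real \<Rightarrow> (real \<Rightarrow> 'a \<Rightarrow> real) \<Rightarrow> bool" where
  "stable_subordinator a X \<longleftrightarrow>
     0 < a \<and> a < 1 \<and> subordinator X \<and>
     (\<forall>t\<ge>0. \<forall>w>0. expectation (\<lambda>\<omega>. exp (- w * X t \<omega>)) = exp (- t * w powr a))"

text \<open>
  Independence of the coordinate processes is independence of the random elements
  \<open>(D\<^sub>i(s))\<^sub>s\<^sub>\<ge>\<^sub>0\<close> of the product space.
\<close>

definition multi_stable_subordinator ::
    "real ^ 'd \<Rightarrow> ('d \<Rightarrow> real \<Rightarrow> 'a \<Rightarrow> real) \<Rightarrow> bool" where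
  "multi_stable_subordinator \<alpha> D \<longleftrightarrow>
     (\<forall>i. stable_subordinator (\<alpha> $ i) (D i)) \<and>
     indep_vars (\<lambda>_. PiM {0..} (\<lambda>_. borel)) (\<lambda>i \<omega>. \<lambda>s\<in>{0..}. D i s \<omega>) UNIV"

definition process_events :: "'t set \<Rightarrow> 'b measure \<Rightarrow> ('t \<Rightarrow> 'a \<Rightarrow> 'b) \<Rightarrow> 'a set set" where
  "process_events T S X =
     sets (vimage_algebra (space M) (\<lambda>\<omega>. \<lambda>t\<in>T. X t \<omega>) (PiM T (\<lambda>_. S)))"

end

definition vec_process :: "('d \<Rightarrow> real \<Rightarrow> 'a \<Rightarrow> real) \<Rightarrow> real ^ 'd \<Rightarrow> 'a \<Rightarrow> real ^ 'd" where
  "vec_process D t \<omega> = (\<chi> i. D i (t $ i) \<omega>)"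

text \<open>
  A monotone function of several variables need not be Borel, so \<open>N(D(t))\<close> need not be measurable
  for \<open>P\<close> itself; probabilities are therefore taken in the completion of \<open>P\<close>, which
  agrees with \<open>P\<close> on the events of \<open>P\<close>.
\<close>

definition subordinated_pmf ::
    "'a measure \<Rightarrow> (real ^ 'd \<Rightarrow> 'a \<Rightarrow> int) \<Rightarrow> (real ^ 'd \<Rightarrow> 'a \<Rightarrow> real ^ 'd) \<Rightarrow>
      nat \<Rightarrow> real ^ 'd \<Rightarrow> real" where
  "subordinated_pmf P N T n t = measure (completion P) {\<omega> \<in> space P. N (T t \<omega>) \<omega> = int n}"

text \<open>Operators on sequences \<open>f 0, f 1, \<dots>\<close>, extended by \<open>f m = 0\<close> for \<open>m < 0\<close>.\<close>

definition bshift :: "(nat \<Rightarrow> real) \<Rightarrow> nat \<Rightarrow> real" where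
  "bshift f n = (if n = 0 then 0 else f (n - 1))"

definition shift_comb :: "nat \<Rightarrow> (nat \<Rightarrow> real) \<Rightarrow> (nat \<Rightarrow> real) \<Rightarrow> nat \<Rightarrow> real" where
  "shift_comb k c f n = (\<Sum>j=1..k. c j * (bshift ^^ j) f n)"

text \<open>
  \<open>frac_diff_op k c a\<close> is \<open>(\<Sum>j=1..k. c j (I - B\<^sup>j))\<^sup>a\<close>, defined through the binomial expansion around
  \<open>\<mu> = c 1 + \<dots> + c k\<close>.  In the series below only the terms with \<open>r \<le> n\<close> can be nonzero.
\<close>

definition frac_diff_op :: "nat \<Rightarrow> (nat \<Rightarrow> real) \<Rightarrow> real \<Rightarrow> (nat \<Rightarrow> real) \<Rightarrow> nat \<Rightarrow> real" where
  "frac_diff_op k c a f n =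
     (let \<mu> = (\<Sum>j=1..k. c j) in
      \<mu> powr a * (\<Sum>r. (a gchoose r) * (- 1 / \<mu>) ^ r * (shift_comb k c ^^ r) f n))"

text \<open>
  \<open>rGamma\<close> is the entire function \<open>1 / \<Gamma>\<close>, which vanishes at the non-positive integers.
\<close>

definition series_term :: "real \<Rightarrow> real \<Rightarrow> real \<Rightarrow> nat \<Rightarrow> nat \<Rightarrow> real" where
  "series_term a \<mu> t m r =
     (- (\<mu> powr a) * t) ^ r * Gamma (a * real r + 1) / fact r * rGamma (a * real r + 1 - real m)"

end

theory Submission
  imports Defs
begin

text \<open>
  Conditioning on the subordinator turns the distribution into \<open>E[q\<^sub>n(D(t))]\<close>, where \<open>q\<^sub>n(s)\<close> is the
  coefficient of \<open>z\<^sup>n\<close> in \<open>exp (- (\<Sum>\<^sub>i s\<^sub>i \<psi>\<^sub>i(z)))\<close> with \<open>\<psi>\<^sub>i(z) = \<Sum>\<^sub>j \<lambda>\<^sub>j\<^sub>i (1 - z\<^sup>j)\<close>.  By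
  monotonicity \<open>N(D(t))\<close> lies between its values at grid points below and above \<open>D(t)\<close>; there
  independence of countably many events suffices, and continuity of \<open>q\<^sub>n\<close> lets the mesh tend to 0.
  Both the sum over \<open>Theta\<close> and that over \<open>Omega\<close> come from \<open>exp\<close> of a sum of power series.

  What remains are the moments \<open>E[D\<^sup>m exp (- \<mu> D)]\<close>.  They are read off by comparing coefficients of
  \<open>v\<close> in \<open>E[exp (- (\<mu> - v) D)] = exp (- t (\<mu> - v)\<^sup>\<alpha>)\<close>, whose right-hand side is expanded as a double
  series.  The one-dimensional weights thus have the generating function \<open>exp (- t \<psi>\<^sub>i(z)\<^sup>\<alpha>)\<close>, whose
  derivative in \<open>t\<close> is multiplication by \<open>- \<psi>\<^sub>i(z)\<^sup>\<alpha>\<close>; on coefficient sequences this is the fractional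
  difference operator.
\<close>

section \<open>Exponentials of formal power series\<close>

text \<open>The product of exp(cA), exp(cB) and exp(-c(A + B)) has derivative 0 and constant term 1,
  so it is 1. Since exp(-c(A + B)) is also inverse to exp(c(A + B)), uniqueness of inverses gives
  the claim.\<close>

lemma fps_exp_compose_add:
  fixes A B :: "'a::field_char_0 fps"
  assumes "fps_nth A 0 = 0" "fps_nth B 0 = 0"
  shows "fps_exp c oo (A + B) = (fps_exp c oo A) * (fps_exp c oo B)"
proof -
  have inv: "(fps_exp c oo Y) * (fps_exp (- c) oo Y) = 1" if "fps_nth Y 0 = 0" for Y :: "'a fps"
    using fps_compose_mult_distrib[OF that, of "fps_exp c" "fps_exp (- c)"]
    by (simp flip: fps_exp_add_mult)
  define F where
    "F = (fps_exp c oo A) * (fps_exp c oo B) * (fps_exp (- c) oo (A + B))"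
  have "fps_deriv F = 0"
    using assms
    by (simp add: F_def fps_compose_deriv fps_compose_mult_distrib fps_compose_uminus algebra_simps fps_const_neg[symmetric]
             del: fps_const_neg)
  then have "F = fps_const (fps_nth F 0)"
    by (simp only: fps_deriv_eq_0_iff)
  also have "fps_nth F 0 = 1"
    by (simp add: F_def)
  finally have "F = 1" by simp
  moreover have "(fps_exp c oo (A + B)) * (fps_exp (- c) oo (A + B)) = 1"
    using inv[of "A + B"] assms by simp
  moreover have "P * R = 1 \<Longrightarrow> E * R = 1 \<Longrightarrow> E = P" for P E R :: "'a fps"
    by (metis mult.assoc mult.commute mult_1_right)
  ultimately show ?thesis
    unfolding F_def by blast
qed

lemma fps_exp_compose_sum:
  fixes F :: "'b \<Rightarrow> 'a::field_char_0 fps"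
  assumes "\<And>i. i \<in> I \<Longrightarrow> fps_nth (F i) 0 = 0"
  shows "fps_exp c oo (\<Sum>i\<in>I. F i) = (\<Prod>i\<in>I. fps_exp c oo F i)"
  using assms
proof (induction I rule: infinite_finite_induct)
  case (insert i I)
  then show ?case
    by (simp add: fps_exp_compose_add fps_sum_nth)
qed auto

text \<open>The index set of a Cauchy product with factors indexed by \<open>A\<close>.
  Extensionality makes it finite for finite \<open>A\<close>; over \<open>UNIV\<close> it becomes
  \<open>Theta\<close>.\<close>

definition weak_compositions :: "'a set \<Rightarrow> nat \<Rightarrow> ('a \<Rightarrow> nat) set" where
  "weak_compositions A n = {m \<in> A \<rightarrow>\<^sub>E UNIV. sum m A = n}"

lemma finite_weak_compositions: "finite A \<Longrightarrow> finite (weak_compositions A n)"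
  by (rule finite_subset[of _ "A \<rightarrow>\<^sub>E {..n}"])
     (auto simp: weak_compositions_def PiE_iff intro!: finite_PiE member_le_sum elim: extensional_arb)

lemma fps_nth_prod:
  fixes f :: "'a \<Rightarrow> 'b::comm_semiring_1 fps"
  assumes "finite A"
  shows "fps_nth (\<Prod>a\<in>A. f a) n = (\<Sum>m\<in>weak_compositions A n. \<Prod>a\<in>A. fps_nth (f a) (m a))"
  using assms
proof (induction A arbitrary: n rule: finite_induct)
  case empty
  have "weak_compositions ({} :: 'a set) n = (if n = 0 then {\<lambda>_. undefined} else {})"
    by (auto simp: weak_compositions_def)
  then show ?case by simp
next
  case (insert a A)
  let ?g = "\<lambda>m. (m a, restrict m A)"
  \<comment> \<open>Splitting a composition into its value at \<open>a\<close> and its restriction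
    to \<open>A\<close> reduces the claim to a Cauchy product of two factors.\<close>
  have "(\<Sum>m\<in>weak_compositions (insert a A) n. \<Prod>b\<in>insert a A. fps_nth (f b) (m b)) =
        (\<Sum>(i, m)\<in>Sigma {..n} (\<lambda>i. weak_compositions A (n - i)). fps_nth (f a) i * (\<Prod>b\<in>A. fps_nth (f b) (m b)))"
  proof (rule sum.reindex_bij_witness[of _ "\<lambda>(i, m). m(a := i)" ?g], goal_cases)
    case (1 m)
    then show ?case
      by (fastforce simp: weak_compositions_def PiE_iff extensional_def restrict_def)
  next
    case (2 m)
    have "sum (restrict m A) A = sum m A" by (rule sum.cong) auto
    with 2 insert.hyps show ?case
      by (auto simp: weak_compositions_def)
  next
    case (3 b)
    with insert.hyps show ?case
      by (auto simp: weak_compositions_def PiE_iff extensional_def restrict_def fun_eq_iff)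
  next
    case (4 b)
    have "sum (m(a := i)) A = sum m A" for m :: "'a \<Rightarrow> nat" and i
      by (rule sum.cong) (use insert.hyps in auto)
    with 4 insert.hyps show ?case
      by (auto simp: weak_compositions_def PiE_iff extensional_def)
  next
    case (5 m)
    have "(\<Prod>b\<in>A. fps_nth (f b) (restrict m A b)) = (\<Prod>b\<in>A. fps_nth (f b) (m b))"
      by (rule prod.cong) auto
    with insert.hyps show ?case by simp
  qed
  also have "\<dots> = (\<Sum>i\<le>n. fps_nth (f a) i * fps_nth (\<Prod>b\<in>A. f b) (n - i))"
    by (simp add: insert.IH sum_distrib_left sum.Sigma finite_weak_compositions insert.hyps)
  finally show ?case
    using insert.hyps by (simp add: fps_mult_nth atLeast0AtMost)
qed

lemma Theta_eq_weak_compositions: "Theta n = weak_compositions UNIV n"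
  by (simp add: Theta_def weak_compositions_def PiE_UNIV_domain)

text \<open>Only the i-th power of the monomial with \<open>j * i = m\<close> reaches degree
  \<open>m\<close>; \<open>j \<ge> 1\<close> makes this i unique.\<close>

lemma fps_exp_compose_monom_nth:
  fixes a :: "'a::field_char_0"
  assumes "j \<ge> 1"
  shows "fps_nth (fps_exp 1 oo (fps_const a * fps_X ^ j)) m =
         (if j dvd m then a ^ (m div j) / fact (m div j) else 0)"
proof -
  have "fps_nth (fps_exp 1 oo (fps_const a * fps_X ^ j)) m =
        (\<Sum>i=0..m. if m = j * i then a ^ i / fact i else 0)"
    unfolding fps_compose_nth
    by (rule sum.cong) (auto simp: power_mult_distrib fps_const_power simp flip: power_mult)
  also have "\<dots> = (\<Sum>i=0..m. if i = m div j then (if j dvd m then a ^ i / fact i else 0) else 0)"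
    using assms by (intro sum.cong) auto
  also have "\<dots> = (if j dvd m then a ^ (m div j) / fact (m div j) else 0)"
    by (subst sum.delta) auto
  finally show ?thesis .
qed

text \<open>In terms of \<psi>, this series is \<psi>(0) - \<psi>(z). Its zero constant term makes
  composition with exponential and binomial series well behaved.\<close>

definition transition_fps :: "nat \<Rightarrow> (nat \<Rightarrow> real) \<Rightarrow> real fps" where
  "transition_fps k c = (\<Sum>j=1..k. fps_const (c j) * fps_X ^ j)"

lemma transition_fps_nth_0 [simp]: "fps_nth (transition_fps k c) 0 = 0"
  by (simp add: transition_fps_def fps_sum_nth)

text \<open>The exponential of the sum is the product of the factors exp(c_j z^j), and the j-th
  factor contributes only degrees of the form \<open>j * x j\<close>.\<close>

lemma fps_exp_transition_fps_nth:
  "fps_nth (fps_exp 1 oo transition_fps k c) n = (\<Sum>x\<in>Omega k n. \<Prod>j=1..k. c j ^ x j / fact (x j))"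
proof -
  let ?e = "\<lambda>j m. if j dvd m then c j ^ (m div j) / fact (m div j) else 0"
  have "fps_nth (fps_exp 1 oo transition_fps k c) n =
        (\<Sum>m\<in>weak_compositions {1..k} n. \<Prod>j=1..k. ?e j (m j))"
    unfolding transition_fps_def
    by (subst fps_exp_compose_sum)
       (auto simp: fps_nth_prod fps_exp_compose_monom_nth intro!: sum.cong prod.cong)
  also have "\<dots> = (\<Sum>m\<in>{m \<in> weak_compositions {1..k} n. \<forall>j\<in>{1..k}. j dvd m j}.
                    \<Prod>j=1..k. ?e j (m j))"
    by (rule sum.mono_neutral_right) (auto simp: finite_weak_compositions)
  \<comment> \<open>The surviving compositions correspond to solutions in \<open>Omega\<close>
    through \<open>m j = j * x j\<close>.\<close>
  also have "\<dots> = (\<Sum>x\<in>Omega k n. \<Prod>j=1..k. c j ^ x j / fact (x j))"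
  proof (rule sum.reindex_bij_witness[of _ "\<lambda>x. \<lambda>j\<in>{1..k}. j * x j" "\<lambda>m. \<lambda>j\<in>{1..k}. m j div j"],
         goal_cases)
    case (1 m)
    then show ?case
      by (auto simp: weak_compositions_def PiE_iff extensional_def fun_eq_iff)
  next
    case (2 m)
    then have "(\<Sum>j=1..k. j * (m j div j)) = (\<Sum>j=1..k. m j)"
      by (intro sum.cong) auto
    with 2 show ?case
      by (auto simp: weak_compositions_def Omega_def)
  next
    case (3 x)
    then show ?case
      by (auto simp: Omega_def PiE_iff extensional_def fun_eq_iff)
  next
    case (4 x)
    then show ?case
      by (auto simp: weak_compositions_def Omega_def)
  next
    case (5 m)
    then show ?case
      by (intro prod.cong) auto
  qed
  finally show ?thesis .
qed

text \<open>Isolates the powers of \<open>s\<close>: after substitution of a subordinator for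
  \<open>s\<close>, only exponentially damped moments remain to be computed.\<close>

lemma fps_exp_compose_nth_scaled:
  fixes F :: "'a::field_char_0 fps"
  shows "fps_nth (fps_exp 1 oo (fps_const s * F)) n = (\<Sum>M=0..n. s ^ M * (fps_nth (F ^ M) n / fact M))"
  by (simp add: fps_compose_nth power_mult_distrib fps_const_power field_simps)

lemma sum_transition_fps:
  "(\<Sum>i\<in>I. fps_const (s i) * transition_fps k (c i)) = transition_fps k (\<lambda>j. \<Sum>i\<in>I. c i j * s i)"
proof -
  have "(\<Sum>i\<in>I. fps_const (s i) * transition_fps k (c i)) =
        (\<Sum>j=1..k. \<Sum>i\<in>I. fps_const (c i j * s i) * fps_X ^ j)"
    unfolding transition_fps_def sum_distrib_left
    by (subst sum.swap) (simp add: fps_const_mult[symmetric] ac_simps del: fps_const_mult)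
  also have "\<dots> = transition_fps k (\<lambda>j. \<Sum>i\<in>I. c i j * s i)"
  proof -
    have "(\<Sum>i\<in>I. fps_const (f i)) = fps_const (\<Sum>i\<in>I. f i)" for f :: "_ \<Rightarrow> real"
      by (simp add: fps_eq_iff fps_sum_nth)
    then show ?thesis
      by (simp add: transition_fps_def sum_distrib_right[symmetric])
  qed
  finally show ?thesis .
qed

text \<open>The coefficient of \<open>z\<^sup>n\<close> in \<open>exp (- s \<psi>(z))\<close>, \<open>\<psi>(z) = \<Sum>\<^sub>j c\<^sub>j (1 - z\<^sup>j)\<close>.\<close>

definition gcp_weight :: "nat \<Rightarrow> (nat \<Rightarrow> real) \<Rightarrow> nat \<Rightarrow> real \<Rightarrow> real" where
  "gcp_weight k c n s = exp (- (\<Sum>j=1..k. c j) * s) * fps_nth (fps_exp 1 oo (fps_const s * transition_fps k c)) n"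

text \<open>For nonnegative rates and times, this identifies the weight with the point probability
  of a one-parameter GCP at time \<open>s\<close>.\<close>

lemma gcp_weight_eq_Omega:
  "gcp_weight k c n s = (\<Sum>x\<in>Omega k n. \<Prod>j=1..k. (c j * s) ^ x j / fact (x j) * exp (- (c j * s)))"
proof -
  have "fps_const s * transition_fps k c = transition_fps k (\<lambda>j. c j * s)"
    using sum_transition_fps[of "\<lambda>_. s" k "\<lambda>_. c" "{()}"] by simp
  moreover have "exp (- (\<Sum>j=1..k. c j) * s) = (\<Prod>j=1..k. exp (- (c j * s)))"
    by (simp add: exp_sum[symmetric] sum_distrib_right sum_negf)
  ultimately show ?thesis
    by (simp add: gcp_weight_def fps_exp_transition_fps_nth sum_distrib_left prod.distrib[symmetric] ac_simps)
qed

text \<open>The exponent of the generating function is linear in \<open>t\<close>, so the generating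
  function factors over the coordinates. The law is therefore a convolution of one-parameter laws,
  and \<open>Theta\<close> indexes that convolution.\<close>

lemma gcp_pmf_eq_Theta:
  fixes \<Lambda> :: "nat \<Rightarrow> real ^ 'd"
  shows "(\<Sum>x\<in>Omega k n. \<Prod>j=1..k. (\<Lambda> j \<bullet> t) ^ x j / fact (x j) * exp (- (\<Lambda> j \<bullet> t))) =
         (\<Sum>m\<in>Theta n. \<Prod>i\<in>UNIV. gcp_weight k (\<lambda>j. \<Lambda> j $ i) (m i) (t $ i))"
proof -
  let ?E = "\<lambda>i. exp (- (\<Sum>j=1..k. \<Lambda> j $ i) * t $ i)"
  let ?F = "\<lambda>i. fps_const (t $ i) * transition_fps k (\<lambda>j. \<Lambda> j $ i)"
  have F: "(\<Sum>i\<in>UNIV. ?F i) = transition_fps k (\<lambda>j. \<Lambda> j \<bullet> t)"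
    by (simp add: sum_transition_fps inner_vec_def)
  have "(\<Prod>j=1..k. exp (- (\<Lambda> j \<bullet> t))) = exp (- (\<Sum>j=1..k. \<Lambda> j \<bullet> t))"
    by (simp add: exp_sum[symmetric] sum_negf)
  also have "\<dots> = exp (\<Sum>i\<in>UNIV. - (\<Sum>j=1..k. \<Lambda> j $ i) * t $ i)"
    by (simp add: inner_vec_def sum_distrib_right sum_negf sum.swap[of _ UNIV])
  also have "\<dots> = (\<Prod>i\<in>UNIV. ?E i)"
    by (rule exp_sum) simp
  finally have E: "(\<Prod>j=1..k. exp (- (\<Lambda> j \<bullet> t))) = (\<Prod>i\<in>UNIV. ?E i)" .
  have "(\<Sum>m\<in>Theta n. \<Prod>i\<in>UNIV. gcp_weight k (\<lambda>j. \<Lambda> j $ i) (m i) (t $ i)) =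
        (\<Prod>i\<in>UNIV. ?E i) * fps_nth (\<Prod>i\<in>UNIV. fps_exp 1 oo ?F i) n"
    by (simp add: gcp_weight_def prod.distrib fps_nth_prod Theta_eq_weak_compositions sum_distrib_left)
  also have "(\<Prod>i\<in>UNIV. fps_exp 1 oo ?F i) = fps_exp 1 oo transition_fps k (\<lambda>j. \<Lambda> j \<bullet> t)"
    by (subst fps_exp_compose_sum[symmetric]) (simp_all add: F)
  finally show ?thesis
    unfolding fps_exp_transition_fps_nth E[symmetric] sum_distrib_left prod.distrib[symmetric]
    by (simp add: ac_simps)
qed

section \<open>Moments of stable subordinators\<close>

text \<open>Once the coefficients below \<open>n\<close> vanish, dividing by x^n for nonzero x
  leaves a series with sum 0 whose constant term is \<open>a n\<close>; letting x tend to 0 shows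
  that this term is 0.\<close>

lemma powser_sums_0_imp_coeffs_0:
  fixes a :: "nat \<Rightarrow> 'a::{real_normed_field,banach}"
  assumes "0 < R" and sums: "\<And>x. norm x < R \<Longrightarrow> (\<lambda>n. a n * x ^ n) sums 0"
  shows "a n = 0"
proof (induction n rule: less_induct)
  case (less n)
  have "(\<lambda>i. a (i + n) * x ^ i) sums 0" if x: "x \<noteq> 0" "norm x < R" for x
  proof -
    have "(\<lambda>i. a (i + n) * x ^ (i + n)) sums (0 - (\<Sum>i<n. a i * x ^ i))"
      using sums[OF x(2)] by (rule sums_split_initial_segment)
    then have "(\<lambda>i. a (i + n) * x ^ (i + n)) sums 0"
      by (simp add: less)
    then have "(\<lambda>i. x ^ n * (a (i + n) * x ^ i)) sums (x ^ n * 0)"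
      by (simp add: power_add ac_simps)
    then show ?thesis
      using sums_divide[of _ 0 "x ^ n"] x by fastforce
  qed
  then have "((\<lambda>_. 0) \<longlongrightarrow> a (0 + n)) (at (0 :: 'a))"
    by (intro powser_limit_0_strong[OF \<open>0 < R\<close>]) auto
  from LIM_const_eq[OF this] show ?case
    by simp
qed

lemma powser_sums_unique:
  fixes a b :: "nat \<Rightarrow> 'a::{real_normed_field,banach}"
  assumes "0 < R"
    and "\<And>x. norm x < R \<Longrightarrow> (\<lambda>n. a n * x ^ n) sums f x"
    and "\<And>x. norm x < R \<Longrightarrow> (\<lambda>n. b n * x ^ n) sums f x"
  shows "a n = b n"
proof -
  have "(\<lambda>n. (a n - b n) * x ^ n) sums 0" if "norm x < R" for x
    using sums_diff[OF assms(2)[OF that] assms(3)[OF that]] by (simp add: left_diff_distrib)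
  from powser_sums_0_imp_coeffs_0[OF \<open>0 < R\<close> this] show ?thesis
    by simp
qed

text \<open>The quotient \<Gamma>(z)/\<Gamma>(z - M) at z = ar + 1 is the falling factorial of ar of
  length M. Working with \<open>rGamma\<close> covers the case in which z - M is a pole of
  \<Gamma>.\<close>

lemma series_term_eq_gbinomial:
  assumes "0 < a"
  shows "series_term a \<mu> t M r =
         fact M * ((- (\<mu> powr a) * t) ^ r / fact r * ((a * real r) gchoose M))"
proof -
  let ?z = "a * real r + 1"
  have "?z > 0"
    using assms by (simp add: add_nonneg_pos)
  then have "?z \<notin> \<int>\<^sub>\<le>\<^sub>0"
    by (auto dest: nonpos_Ints_nonpos)
  then have "Gamma ?z * rGamma ?z = 1"
    by (simp add: Gamma_def rGamma_eq_zero_iff)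
  then have "Gamma ?z * rGamma (?z - real M) = pochhammer (?z - real M) M"
    using pochhammer_rGamma[of "?z - real M" M] by simp
  also have "\<dots> = fact M * ((a * real r) gchoose M)"
    by (simp add: gbinomial_pochhammer' algebra_simps)
  finally show ?thesis
    by (simp add: series_term_def mult.assoc)
qed

text \<open>Each factor satisfies |a - i| \<le> a + i. The bound is the coefficient of y^M in (1 -
  y)^(-a), which serves as a majorant series below.\<close>

lemma abs_gbinomial_le:
  fixes a :: real
  assumes "0 \<le> a"
  shows "\<bar>a gchoose M\<bar> \<le> (-1) ^ M * ((- a) gchoose M)"
proof -
  have "\<bar>a gchoose M\<bar> = (\<Prod>i=0..<M. \<bar>a - real i\<bar>) / fact M"
    by (simp add: gbinomial_prod_rev abs_prod)
  also have "\<dots> \<le> (\<Prod>i=0..<M. a + real i) / fact M"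
    using assms by (intro divide_right_mono prod_mono) auto
  also have "\<dots> = (-1) ^ M * ((- a) gchoose M)"
    by (simp add: gbinomial_pochhammer pochhammer_prod power_mult_distrib[symmetric])
  finally show ?thesis .
qed

lemma abs_gbinomial_sums:
  fixes a y :: real
  assumes "0 \<le> a" "0 \<le> y" "y < 1"
  shows "summable (\<lambda>M. \<bar>a gchoose M\<bar> * y ^ M)"
    and "(\<Sum>M. \<bar>a gchoose M\<bar> * y ^ M) \<le> (1 - y) powr (- a)"
proof -
  have *: "(\<lambda>M. (-1) ^ M * ((- a) gchoose M) * y ^ M) sums (1 - y) powr (- a)"
    using gen_binomial_real[of "- y" "- a"] assms
    by (simp add: power_minus[of y] ac_simps)
  have le: "\<bar>a gchoose M\<bar> * y ^ M \<le> (-1) ^ M * ((- a) gchoose M) * y ^ M" for M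
    using abs_gbinomial_le[OF \<open>0 \<le> a\<close>] assms by (intro mult_right_mono) auto
  show s: "summable (\<lambda>M. \<bar>a gchoose M\<bar> * y ^ M)"
    by (rule summable_comparison_test'[OF sums_summable[OF *]]) (use le assms in auto)
  show "(\<Sum>M. \<bar>a gchoose M\<bar> * y ^ M) \<le> (1 - y) powr (- a)"
    using suminf_le[OF le s sums_summable[OF *]] sums_unique[OF *] by simp
qed

lemma abs_gbinomial_bound:
  fixes a y :: real
  assumes "0 \<le> a" "0 \<le> y" "y < 1"
  shows "\<bar>a gchoose M\<bar> * y ^ M \<le> (1 - y) powr (- a)"
proof -
  have "\<bar>a gchoose M\<bar> * y ^ M = (\<Sum>i\<in>{M}. \<bar>a gchoose i\<bar> * y ^ i)"
    by simp
  also have "\<dots> \<le> (\<Sum>M. \<bar>a gchoose M\<bar> * y ^ M)"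
    by (rule sum_le_suminf) (use abs_gbinomial_sums[OF assms] assms in auto)
  finally show ?thesis
    using abs_gbinomial_sums(2)[OF assms] by linarith
qed

text \<open>Evaluating the majorant at y = 1/2 bounds the binomial coefficient by 2^M (2^a)^r. This
  is geometric in r, so an exponential series dominates.\<close>

lemma summable_abs_pow_fact_gbinomial:
  fixes a x :: real
  assumes "0 \<le> a"
  shows "summable (\<lambda>r. \<bar>x ^ r / fact r * ((a * real r) gchoose M)\<bar>)"
proof (rule summable_comparison_test')
  show "summable (\<lambda>r. 2 ^ M * ((\<bar>x\<bar> * 2 powr a) ^ r / fact r))"
    using summable_exp[of "\<bar>x\<bar> * 2 powr a"] by (intro summable_mult) (simp add: field_simps)
  fix r :: nat
  have "\<bar>(a * real r) gchoose M\<bar> * (1/2) ^ M \<le> (1/2) powr (- (a * real r))"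
    using abs_gbinomial_bound[of "a * real r" "1/2" M] assms by simp
  also have "(1/2 :: real) powr (- (a * real r)) = (2 powr a) ^ r"
    by (simp add: powr_minus powr_divide powr_powr powr_realpow flip: powr_powr)
  finally have "\<bar>(a * real r) gchoose M\<bar> \<le> 2 ^ M * (2 powr a) ^ r"
    by (simp add: field_simps power_divide)
  then have "\<bar>x\<bar> ^ r / fact r * \<bar>(a * real r) gchoose M\<bar> \<le> \<bar>x\<bar> ^ r / fact r * (2 ^ M * (2 powr a) ^ r)"
    by (intro mult_left_mono) auto
  then show "norm \<bar>x ^ r / fact r * ((a * real r) gchoose M)\<bar> \<le> 2 ^ M * ((\<bar>x\<bar> * 2 powr a) ^ r / fact r)"
    by (simp add: abs_mult power_abs power_mult_distrib ac_simps)
qed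

lemmas summable_pow_fact_gbinomial = summable_rabs_cancel[OF summable_abs_pow_fact_gbinomial]

lemma summable_series_term:
  assumes "0 < a"
  shows "summable (series_term a \<mu> t M)"
proof -
  have "series_term a \<mu> t M = (\<lambda>r. fact M * ((- (\<mu> powr a) * t) ^ r / fact r * ((a * real r) gchoose M)))"
    using series_term_eq_gbinomial[OF assms] by (intro ext)
  then show ?thesis
    using assms by (simp only:) (intro summable_mult summable_pow_fact_gbinomial, simp)
qed

text \<open>Expanding the outer exponential in r and then each (1 + y)^(ar) in M gives a double
  series. Absolute convergence permits summing over r first, which collects the coefficient of
  y^M.\<close>

lemma exp_powr_expansion:
  fixes a x y :: real
  assumes "0 \<le> a" "\<bar>y\<bar> < 1"
  shows "(\<lambda>M. (\<Sum>r. x ^ r / fact r * ((a * real r) gchoose M)) * y ^ M) sums exp (x * (1 + y) powr a)"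
proof -
  define f where "f = (\<lambda>(r, M). x ^ r / fact r * ((a * real r) gchoose M) * y ^ M)"
  have row_abs: "summable (\<lambda>M. \<bar>f (r, M)\<bar>)"
      "(\<Sum>M. \<bar>f (r, M)\<bar>) \<le> \<bar>x\<bar> ^ r / fact r * (1 - \<bar>y\<bar>) powr (- (a * real r))" for r
  proof -
    have "a * real r \<ge> 0" using assms by simp
    note s = abs_gbinomial_sums[OF this, of "\<bar>y\<bar>"]
    have eq: "(\<lambda>M. \<bar>f (r, M)\<bar>) = (\<lambda>M. \<bar>x\<bar> ^ r / fact r * (\<bar>(a * real r) gchoose M\<bar> * \<bar>y\<bar> ^ M))"
      by (simp add: f_def abs_mult power_abs ac_simps)
    show "summable (\<lambda>M. \<bar>f (r, M)\<bar>)"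
      unfolding eq using s(1) assms by (intro summable_mult) auto
    show "(\<Sum>M. \<bar>f (r, M)\<bar>) \<le> \<bar>x\<bar> ^ r / fact r * (1 - \<bar>y\<bar>) powr (- (a * real r))"
      unfolding eq using s assms by (subst suminf_mult) (auto intro!: mult_left_mono divide_right_mono)
  qed
  have row: "((\<lambda>M. f (r, M)) has_sum x ^ r / fact r * ((1 + y) powr a) ^ r) UNIV" for r
  proof -
    have "(\<lambda>M. ((a * real r) gchoose M) * y ^ M) sums (1 + y) powr (a * real r)"
      using assms by (intro gen_binomial_real) auto
    then have "(\<lambda>M. f (r, M)) sums (x ^ r / fact r * (1 + y) powr (a * real r))"
      unfolding f_def prod.case mult.assoc by (intro sums_mult) auto
    moreover have "(1 + y) powr (a * real r) = ((1 + y) powr a) ^ r"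
      using assms by (simp add: powr_realpow flip: powr_powr)
    ultimately show ?thesis
      using row_abs(1) by (intro norm_summable_imp_has_sum) auto
  qed
  \<comment> \<open>The bounds on the absolute row sums are themselves the terms of the series for
    exp(|x| (1 - |y|)^(-a)).\<close>
  have "summable (\<lambda>r. \<bar>x\<bar> ^ r / fact r * (1 - \<bar>y\<bar>) powr (- (a * real r)))"
  proof -
    have "(1 - \<bar>y\<bar>) powr (- (a * real r)) = ((1 - \<bar>y\<bar>) powr (- a)) ^ r" for r
      using assms by (simp add: powr_realpow[symmetric] powr_powr)
    then show ?thesis
      using summable_exp[of "\<bar>x\<bar> * (1 - \<bar>y\<bar>) powr (- a)"] by (simp add: power_mult_distrib field_simps)
  qed
  then have "summable (\<lambda>r. \<Sum>M. \<bar>f (r, M)\<bar>)"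
    by (rule summable_comparison_test'[where N = 0]) (use row_abs in \<open>auto simp: suminf_nonneg\<close>)
  then have g: "(\<lambda>r. \<Sum>M. \<bar>f (r, M)\<bar>) summable_on UNIV"
    using row_abs(1) by (intro norm_summable_imp_summable_on) (simp add: suminf_nonneg)
  have "(\<lambda>rM. \<bar>f rM\<bar>) summable_on UNIV \<times> UNIV"
    using row_abs(1) by (intro summable_on_SigmaI[OF norm_summable_imp_has_sum g]) auto
  then have "f summable_on UNIV \<times> UNIV"
    using abs_summable_summable[of f] by (simp only: real_norm_def)
  moreover have "((\<lambda>r. x ^ r / fact r * ((1 + y) powr a) ^ r) has_sum exp (x * (1 + y) powr a)) UNIV"
  proof (rule norm_summable_imp_has_sum)
    show "summable (\<lambda>r. norm (x ^ r / fact r * ((1 + y) powr a) ^ r))"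
      using summable_norm_exp[of "x * (1 + y) powr a"] by (simp add: power_mult_distrib field_simps)
    show "(\<lambda>r. x ^ r / fact r * ((1 + y) powr a) ^ r) sums exp (x * (1 + y) powr a)"
      using exp_converges[of "x * (1 + y) powr a"] by (simp add: power_mult_distrib field_simps)
  qed
  ultimately have "(f has_sum exp (x * (1 + y) powr a)) (UNIV \<times> UNIV)"
    using row by (intro has_sum_SigmaI)
  then have "((\<lambda>(M, r). f (r, M)) has_sum exp (x * (1 + y) powr a)) (UNIV \<times> UNIV)"
    by (subst (asm) has_sum_swap)
  moreover have "((\<lambda>r. f (r, M)) has_sum (\<Sum>r. x ^ r / fact r * ((a * real r) gchoose M)) * y ^ M) UNIV" for M
  proof (rule norm_summable_imp_has_sum)
    have "(\<lambda>r. (x ^ r / fact r * ((a * real r) gchoose M)) * y ^ M) sums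
          ((\<Sum>r. x ^ r / fact r * ((a * real r) gchoose M)) * y ^ M)"
      by (intro sums_mult2 summable_sums summable_pow_fact_gbinomial assms)
    then show "(\<lambda>r. f (r, M)) sums ((\<Sum>r. x ^ r / fact r * ((a * real r) gchoose M)) * y ^ M)"
      by (simp add: f_def)
    have "norm (f (r, M)) = \<bar>x ^ r / fact r * ((a * real r) gchoose M)\<bar> * \<bar>y ^ M\<bar>" for r
      by (simp add: f_def abs_mult)
    then show "summable (\<lambda>r. norm (f (r, M)))"
      by (simp only:) (intro summable_mult2 summable_abs_pow_fact_gbinomial assms)
  qed
  ultimately have "((\<lambda>M. (\<Sum>r. x ^ r / fact r * ((a * real r) gchoose M)) * y ^ M) has_sum
                     exp (x * (1 + y) powr a)) UNIV"
    using has_sum_SigmaD[where f = "\<lambda>(M, r). f (r, M)"] by fastforce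
  then show ?thesis
    by (rule has_sum_imp_sums)
qed

text \<open>(wy)^M / M! is a single term of the series for exp(wy).\<close>

lemma power_times_exp_minus_le:
  fixes y w :: real
  assumes "0 \<le> y" "0 < w"
  shows "y ^ M * exp (- w * y) \<le> fact M / w ^ M"
proof -
  have "(w * y) ^ M / fact M = (\<Sum>i\<in>{M}. (w * y) ^ i / fact i)"
    by simp
  also have "\<dots> \<le> (\<Sum>i. (w * y) ^ i / fact i)"
    using assms summable_exp[of "w * y"] by (intro sum_le_suminf) (auto simp: field_simps)
  also have "\<dots> = exp (w * y)"
    using exp_converges[of "w * y"] by (simp add: sums_iff field_simps)
  finally show ?thesis
    using assms by (simp add: exp_minus power_mult_distrib field_simps)
qed

section \<open>Exponentially damped moments of a stable subordinator\<close>

context prob_space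
begin

lemma stable_subordinator_nonneg:
  assumes "stable_subordinator a X" "0 \<le> t"
  shows "AE \<omega> in M. 0 \<le> X t \<omega>"
proof -
  have "AE \<omega> in M. X 0 \<omega> = 0" "AE \<omega> in M. \<forall>s t. 0 \<le> s \<longrightarrow> s \<le> t \<longrightarrow> X s \<omega> \<le> X t \<omega>"
    using assms by (auto simp: stable_subordinator_def subordinator_def levy_process_def)
  then show ?thesis
    by eventually_elim (use assms(2) in force)
qed

lemma stable_subordinator_measurable:
  assumes "stable_subordinator a X" "0 \<le> t"
  shows "X t \<in> borel_measurable M"
  using assms by (auto simp: stable_subordinator_def subordinator_def levy_process_def)

lemma
  assumes X: "stable_subordinator a X" and t: "0 \<le> t" and w: "0 < w"
  shows integrable_stable_moment: "integrable M (\<lambda>\<omega>. X t \<omega> ^ m * exp (- w * X t \<omega>))"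
    and stable_moment: "expectation (\<lambda>\<omega>. X t \<omega> ^ m * exp (- w * X t \<omega>)) =
           (- 1 / w) ^ m * (\<Sum>r. series_term a w t m r)"
proof -
  have a: "0 < a"
    using X by (simp add: stable_subordinator_def)
  have laplace: "expectation (\<lambda>\<omega>. exp (- u * X t \<omega>)) = exp (- t * u powr a)" if "0 < u" for u
    using X t that by (simp add: stable_subordinator_def)
  note [measurable] = stable_subordinator_measurable[OF X t]
  note nonneg = stable_subordinator_nonneg[OF X t]
  show int: "integrable M (\<lambda>\<omega>. X t \<omega> ^ m * exp (- w * X t \<omega>))" for m
  proof (rule integrable_const_bound)
    show "AE \<omega> in M. norm (X t \<omega> ^ m * exp (- w * X t \<omega>)) \<le> fact m / w ^ m"
      using nonneg by eventually_elim (use power_times_exp_minus_le[OF _ w] in \<open>simp add: abs_mult\<close>)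
  qed measurable
  define e where "e = (\<lambda>m. expectation (\<lambda>\<omega>. X t \<omega> ^ m * exp (- w * X t \<omega>)))"
  define c where "c = (\<lambda>m. \<Sum>r. (- (w powr a) * t) ^ r / fact r * ((a * real r) gchoose m))"
  have "e m / fact m = c m * (- 1 / w) ^ m"
  \<comment> \<open>The radius is \<open>w\<close> because \<open>w - v\<close> must stay positive
    for the Laplace transform to apply.\<close>
  proof (rule powser_sums_unique[OF w])
    fix v :: real assume "norm v < w"
    then have v: "\<bar>v\<bar> < w" by simp
    let ?f = "\<lambda>m \<omega>. v ^ m / fact m * (X t \<omega> ^ m * exp (- w * X t \<omega>))"
    \<comment> \<open>The absolute partial sums are at most exp((|v| - w) X), hence at most 1. This
      uniform bound justifies exchanging sum and expectation.\<close>
    have partial: "(\<Sum>i<n. norm (?f i \<omega>)) \<le> 1" if "0 \<le> X t \<omega>" for n \<omega>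
    proof -
      have "(\<Sum>i<n. norm (?f i \<omega>)) = (\<Sum>i<n. (\<bar>v\<bar> * X t \<omega>) ^ i / fact i) * exp (- w * X t \<omega>)"
        unfolding sum_distrib_right using that
        by (intro sum.cong) (simp_all add: abs_mult power_abs power_mult_distrib)
      also have "\<dots> \<le> exp (\<bar>v\<bar> * X t \<omega>) * exp (- w * X t \<omega>)"
      proof (rule mult_right_mono)
        have "(\<Sum>i<n. (\<bar>v\<bar> * X t \<omega>) ^ i / fact i) \<le> (\<Sum>i. (\<bar>v\<bar> * X t \<omega>) ^ i / fact i)"
          using that summable_exp[of "\<bar>v\<bar> * X t \<omega>"] by (intro sum_le_suminf) (auto simp: field_simps)
        also have "\<dots> = exp (\<bar>v\<bar> * X t \<omega>)"
          using exp_converges[of "\<bar>v\<bar> * X t \<omega>"] by (simp add: sums_iff field_simps)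
        finally show "(\<Sum>i<n. (\<bar>v\<bar> * X t \<omega>) ^ i / fact i) \<le> exp (\<bar>v\<bar> * X t \<omega>)" .
      qed simp
      also have "\<dots> = exp ((\<bar>v\<bar> - w) * X t \<omega>)"
        by (simp add: exp_add[symmetric] algebra_simps)
      also have "\<dots> \<le> 1"
        using v that by (simp add: mult_nonpos_nonneg)
      finally show ?thesis .
    qed
    have sums_f: "(\<lambda>m. ?f m \<omega>) sums exp (- (w - v) * X t \<omega>)" for \<omega>
    proof -
      have "(\<lambda>m. (v * X t \<omega>) ^ m / fact m * exp (- w * X t \<omega>)) sums
            (exp (v * X t \<omega>) * exp (- w * X t \<omega>))"
        using exp_converges[of "v * X t \<omega>"] by (intro sums_mult2) (simp add: field_simps)
      then show ?thesis
        by (simp add: exp_add[symmetric] power_mult_distrib algebra_simps)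
    qed
    have "(\<lambda>m. expectation (?f m)) sums expectation (\<lambda>\<omega>. \<Sum>m. ?f m \<omega>)"
    proof (rule sums_integral)
      show "integrable M (?f m)" for m
        by (intro integrable_mult_right int)
      show "AE \<omega> in M. summable (\<lambda>m. norm (?f m \<omega>))"
        using nonneg by eventually_elim (rule summableI_nonneg_bounded, use partial in auto)
      show "summable (\<lambda>m. expectation (\<lambda>\<omega>. norm (?f m \<omega>)))"
      proof (rule summableI_nonneg_bounded)
        fix n
        have "(\<Sum>i<n. expectation (\<lambda>\<omega>. norm (?f i \<omega>))) = expectation (\<lambda>\<omega>. \<Sum>i<n. norm (?f i \<omega>))"
          by (intro Bochner_Integration.integral_sum[symmetric] integrable_norm integrable_mult_right int)
        also have "\<dots> \<le> expectation (\<lambda>_. 1)"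
        proof (rule integral_mono_AE)
          show "integrable M (\<lambda>\<omega>. \<Sum>i<n. norm (?f i \<omega>))"
            by (intro Bochner_Integration.integrable_sum integrable_norm integrable_mult_right int)
          show "AE \<omega> in M. (\<Sum>i<n. norm (?f i \<omega>)) \<le> 1"
            using nonneg by eventually_elim (rule partial)
        qed simp
        finally show "(\<Sum>i<n. expectation (\<lambda>\<omega>. norm (?f i \<omega>))) \<le> 1"
          by (simp add: prob_space)
      qed simp
    qed
    also have "(\<lambda>\<omega>. \<Sum>m. ?f m \<omega>) = (\<lambda>\<omega>. exp (- (w - v) * X t \<omega>))"
      using sums_f by (simp add: sums_iff)
    also have "expectation \<dots> = exp (- t * (w - v) powr a)"
      using v by (intro laplace) auto
    finally show "(\<lambda>m. e m / fact m * v ^ m) sums exp (- t * (w - v) powr a)"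
      by (simp add: e_def ac_simps)
    \<comment> \<open>Factoring out \<open>w\<close> brings the Laplace exponent into the form of
      \<open>exp_powr_expansion\<close> with y = -v/w, which is the source of the factor
      (-1/w)^m.\<close>
    have "w * (1 + (- v / w)) = w - v"
      using w by (simp add: field_simps)
    moreover have "(w * (1 + (- v / w))) powr a = w powr a * (1 + (- v / w)) powr a"
      by (rule powr_mult)
    moreover have "(\<lambda>m. c m * (- v / w) ^ m) sums exp (- (w powr a) * t * (1 + (- v / w)) powr a)"
      unfolding c_def using v w a by (intro exp_powr_expansion) (auto simp: field_simps)
    moreover have "(- v / w) ^ m = (- 1 / w) ^ m * v ^ m" for m
      by (simp add: power_mult_distrib[symmetric])
    ultimately show "(\<lambda>m. c m * (- 1 / w) ^ m * v ^ m) sums exp (- t * (w - v) powr a)"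
      by (simp add: ac_simps)
  qed
  then have "e m = (- 1 / w) ^ m * (fact m * c m)"
    by (simp add: field_simps)
  also have "fact m * c m = (\<Sum>r. series_term a w t m r)"
    unfolding c_def series_term_eq_gbinomial[OF a]
    by (intro suminf_mult[symmetric] summable_pow_fact_gbinomial less_imp_le[OF a])
  finally show "expectation (\<lambda>\<omega>. X t \<omega> ^ m * exp (- w * X t \<omega>)) =
           (- 1 / w) ^ m * (\<Sum>r. series_term a w t m r)"
    by (simp add: e_def)
qed

end

text \<open>The coefficient of \<open>z\<^sup>n\<close> in \<open>exp (- t \<psi>(z)\<^sup>a)\<close>, \<open>\<psi>(z) = \<Sum>\<^sub>j c\<^sub>j (1 - z\<^sup>j)\<close>; see \<open>stable_weight_sums\<close>.\<close>

definition stable_weight :: "nat \<Rightarrow> (nat \<Rightarrow> real) \<Rightarrow> real \<Rightarrow> nat \<Rightarrow> real \<Rightarrow> real" where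
  "stable_weight k c a n t = (let \<mu> = \<Sum>j=1..k. c j in
     \<Sum>M=0..n. fps_nth (transition_fps k c ^ M) n / fact M *
       ((- 1 / \<mu>) ^ M * (\<Sum>r. series_term a \<mu> t M r)))"

lemma gcp_weight_eq_powers:
  "gcp_weight k c n s = (\<Sum>M=0..n. fps_nth (transition_fps k c ^ M) n / fact M *
     (s ^ M * exp (- (\<Sum>j=1..k. c j) * s)))"
  unfolding gcp_weight_def fps_exp_compose_nth_scaled sum_distrib_left
  by (simp add: ac_simps)

text \<open>A second expansion in damped powers of \<open>s\<close>. The one by powers of the
  transition series leads to \<open>stable_weight\<close> and the differential equation, this one to
  the explicit formula over \<open>Omega\<close>.\<close>

lemma gcp_weight_eq_Omega_powers:
  "gcp_weight k c n s = (\<Sum>x\<in>Omega k n. (\<Prod>j=1..k. c j ^ x j / fact (x j)) *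
     (s ^ (\<Sum>j=1..k. x j) * exp (- (\<Sum>j=1..k. c j) * s)))"
proof -
  have "(\<Prod>j=1..k. exp (- (c j * s))) = exp (- (\<Sum>j=1..k. c j) * s)"
    by (simp add: exp_sum[symmetric] sum_distrib_right sum_negf)
  then show ?thesis
    unfolding gcp_weight_eq_Omega
    by (simp add: prod.distrib prod_dividef power_mult_distrib power_sum ac_simps)
qed

section \<open>Expected one-parameter weights at a stable time\<close>

context prob_space
begin

lemma
  assumes "stable_subordinator a X" "0 \<le> t" "0 < (\<Sum>j=1..k. c j)"
  shows integrable_gcp_weight: "integrable M (\<lambda>\<omega>. gcp_weight k c n (X t \<omega>))"
    and expectation_gcp_weight: "expectation (\<lambda>\<omega>. gcp_weight k c n (X t \<omega>)) = stable_weight k c a n t"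
    and expectation_gcp_weight_Omega: "expectation (\<lambda>\<omega>. gcp_weight k c n (X t \<omega>)) =
      (\<Sum>x\<in>Omega k n. (\<Prod>j=1..k. (- (c j / (\<Sum>j=1..k. c j))) ^ x j * (1 / fact (x j))) *
         (\<Sum>r. series_term a (\<Sum>j=1..k. c j) t (\<Sum>j=1..k. x j) r))"
proof -
  let ?\<mu> = "\<Sum>j=1..k. c j"
  note int = integrable_stable_moment[OF assms] and mom = stable_moment[OF assms]
  show "integrable M (\<lambda>\<omega>. gcp_weight k c n (X t \<omega>))"
    unfolding gcp_weight_eq_powers by (intro Bochner_Integration.integrable_sum integrable_mult_right int)
  show "expectation (\<lambda>\<omega>. gcp_weight k c n (X t \<omega>)) = stable_weight k c a n t"
    unfolding gcp_weight_eq_powers stable_weight_def Let_def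
    by (subst Bochner_Integration.integral_sum, intro integrable_mult_right int)
       (simp only: integral_mult_right_zero mom)
  \<comment> \<open>The factor (-1/\<mu>)^M from the moment of order M = \<Sum> x j is distributed
    over the rates.\<close>
  have sign: "(\<Prod>j=1..k. c j ^ x j / fact (x j)) * (- 1 / ?\<mu>) ^ (\<Sum>j=1..k. x j) =
        (\<Prod>j=1..k. (- (c j / ?\<mu>)) ^ x j * (1 / fact (x j)))" for x
    unfolding power_sum prod.distrib[symmetric]
    by (intro prod.cong) (simp_all add: power_mult_distrib[symmetric])
  show "expectation (\<lambda>\<omega>. gcp_weight k c n (X t \<omega>)) =
      (\<Sum>x\<in>Omega k n. (\<Prod>j=1..k. (- (c j / ?\<mu>)) ^ x j * (1 / fact (x j))) *
         (\<Sum>r. series_term a ?\<mu> t (\<Sum>j=1..k. x j) r))"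
    unfolding gcp_weight_eq_Omega_powers sign[symmetric]
    by (subst Bochner_Integration.integral_sum, intro integrable_mult_right int)
       (simp only: integral_mult_right_zero mom mult.assoc)
qed

end

section \<open>The fractional difference operator on generating functions\<close>

text \<open>The expansion of \<open>(\<psi>(z) / \<mu>)\<^sup>a\<close> in powers of \<open>z\<close>, where \<open>\<mu> = \<psi>(0)\<close>.\<close>

definition powr_fps :: "nat \<Rightarrow> (nat \<Rightarrow> real) \<Rightarrow> real \<Rightarrow> real fps" where
  "powr_fps k c a = fps_binomial a oo (fps_const (- 1 / (\<Sum>j=1..k. c j)) * transition_fps k c)"

text \<open>The exponent law of binomial series survives composition, which is multiplicative. It
  supplies the extra factor when the series in t is differentiated.\<close>

lemma powr_fps_add: "powr_fps k c (a + b) = powr_fps k c a * powr_fps k c b"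
  by (simp add: powr_fps_def fps_binomial_add_mult fps_compose_mult_distrib)

lemma powr_fps_nth:
  "fps_nth (powr_fps k c a) n =
     (\<Sum>r=0..n. (a gchoose r) * (- 1 / (\<Sum>j=1..k. c j)) ^ r * fps_nth (transition_fps k c ^ r) n)"
  unfolding powr_fps_def fps_compose_nth power_mult_distrib fps_const_power fps_mult_left_const_nth
  by (simp add: ac_simps)

text \<open>On generating functions the backward shift is multiplication by z; the convention for
  negative indices matches the vanishing low coefficients.\<close>

lemma shift_comb_eq_fps_nth: "shift_comb k c f n = fps_nth (transition_fps k c * Abs_fps f) n"
proof -
  have bshift: "(bshift ^^ j) f n = fps_nth (fps_X ^ j * Abs_fps f) n" for j
  proof (induction j arbitrary: n)
    case (Suc j)
    have "(bshift ^^ Suc j) f n = (if n = 0 then 0 else (bshift ^^ j) f (n - 1))"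
      by (simp add: bshift_def)
    then show ?case
      by (simp only: Suc.IH fps_X_power_mult_nth) auto
  qed simp
  show ?thesis
    unfolding shift_comb_def transition_fps_def sum_distrib_right fps_sum_nth mult.assoc
    by (simp add: bshift)
qed

lemma shift_comb_funpow_eq_fps_nth:
  "(shift_comb k c ^^ r) f n = fps_nth (transition_fps k c ^ r * Abs_fps f) n"
proof (induction r arbitrary: n)
  case (Suc r)
  then have "(shift_comb k c ^^ r) f = fps_nth (transition_fps k c ^ r * Abs_fps f)"
    by (intro ext)
  then have "Abs_fps ((shift_comb k c ^^ r) f) = transition_fps k c ^ r * Abs_fps f"
    by (simp add: fps_nth_inverse)
  then show ?case
    using shift_comb_eq_fps_nth[of k c "(shift_comb k c ^^ r) f" n] by (simp add: mult.assoc)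
qed simp

text \<open>The r-th power of the transition series starts at degree r or later, so the operator
  series stops at r = n and becomes multiplication by a single power series.\<close>

lemma frac_diff_op_eq_fps_nth:
  "frac_diff_op k c a f n = (\<Sum>j=1..k. c j) powr a * fps_nth (powr_fps k c a * Abs_fps f) n"
proof -
  let ?\<mu> = "\<Sum>j=1..k. c j" and ?C = "transition_fps k c"
  have zero: "fps_nth (?C ^ r) i = 0" if "i < r" for r i
    using startsby_zero_power_prefix[of ?C r] that by simp
  have "(\<Sum>r. (a gchoose r) * (- 1 / ?\<mu>) ^ r * (shift_comb k c ^^ r) f n) =
        (\<Sum>r=0..n. (a gchoose r) * (- 1 / ?\<mu>) ^ r * fps_nth (?C ^ r * Abs_fps f) n)"
    unfolding shift_comb_funpow_eq_fps_nth
    by (rule suminf_finite) (auto simp: fps_mult_nth zero)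
  also have "\<dots> = (\<Sum>i=0..n. \<Sum>r=0..n. (a gchoose r) * (- 1 / ?\<mu>) ^ r * fps_nth (?C ^ r) i * f (n - i))"
    unfolding fps_mult_nth sum_distrib_left by (subst sum.swap) (simp add: ac_simps)
  also have "\<dots> = (\<Sum>i=0..n. fps_nth (powr_fps k c a) i * f (n - i))"
    unfolding powr_fps_nth sum_distrib_right
    \<comment> \<open>\<open>powr_fps_nth\<close> stops at r = i, the double sum at r = n; the terms
      with i < r vanish.\<close>
    by (intro sum.cong refl sum.mono_neutral_right) (auto simp: zero)
  finally show ?thesis
    by (simp add: frac_diff_op_def Let_def fps_mult_nth)
qed

text \<open>Summing over M first turns the binomial coefficients of ar into the coefficient of
  (\<psi>/\<mu>)^(ar). The result is the expansion of exp(-t \<psi>^a) in powers of t.\<close>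

lemma stable_weight_sums:
  assumes "0 < a"
  shows "(\<lambda>r. (- ((\<Sum>j=1..k. c j) powr a)) ^ r / fact r * fps_nth (powr_fps k c (a * real r)) n * t ^ r)
           sums stable_weight k c a n t"
proof -
  let ?\<mu> = "\<Sum>j=1..k. c j"
  have "(\<lambda>r. \<Sum>M=0..n. fps_nth (transition_fps k c ^ M) n / fact M *
          ((- 1 / ?\<mu>) ^ M * series_term a ?\<mu> t M r)) sums stable_weight k c a n t"
    unfolding stable_weight_def Let_def
    by (intro sums_sum sums_mult summable_sums summable_series_term assms)
  also have "(\<lambda>r. \<Sum>M=0..n. fps_nth (transition_fps k c ^ M) n / fact M *
          ((- 1 / ?\<mu>) ^ M * series_term a ?\<mu> t M r)) =
        (\<lambda>r. (- (?\<mu> powr a)) ^ r / fact r * fps_nth (powr_fps k c (a * real r)) n * t ^ r)"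
    unfolding powr_fps_nth series_term_eq_gbinomial[OF assms] power_mult_distrib
      sum_distrib_left sum_distrib_right
    by (intro ext sum.cong) (simp_all add: field_simps)
  finally show ?thesis .
qed

text \<open>The series in t converges everywhere and may be differentiated termwise. The factor r +
  1 cancels in the factorial, and a(r + 1) = a + ar splits off one factor -\<mu>^a
  (\<psi>/\<mu>)^a.\<close>

lemma stable_weight_has_derivative:
  assumes "0 < a"
  shows "((\<lambda>t. stable_weight k c a n t) has_real_derivative
           - ((\<Sum>j=1..k. c j) powr a) *
             fps_nth (powr_fps k c a * Abs_fps (\<lambda>m. stable_weight k c a m t)) n) (at t)"
proof -
  let ?A = "- ((\<Sum>j=1..k. c j) powr a)"
  define b where "b = (\<lambda>n r. ?A ^ r / fact r * fps_nth (powr_fps k c (a * real r)) n)"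
  have sums: "(\<lambda>r. b n r * t ^ r) sums stable_weight k c a n t" for n t
    unfolding b_def by (rule stable_weight_sums[OF assms])
  have diffs: "diffs (b n) r = ?A * (\<Sum>i=0..n. fps_nth (powr_fps k c a) i * b (n - i) r)" for r
  proof -
    have "powr_fps k c (a * real (Suc r)) = powr_fps k c a * powr_fps k c (a * real r)"
      by (simp add: powr_fps_add[symmetric] algebra_simps)
    then have "diffs (b n) r = real (Suc r) * (?A ^ Suc r / fact (Suc r)) *
                 fps_nth (powr_fps k c a * powr_fps k c (a * real r)) n"
      by (simp only: diffs_def b_def mult.assoc)
    also have "real (Suc r) * (?A ^ Suc r / fact (Suc r)) = ?A * (?A ^ r / fact r)"
      by (simp del: of_nat_Suc)
    also have "?A * (?A ^ r / fact r) * fps_nth (powr_fps k c a * powr_fps k c (a * real r)) n =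
        ?A * (\<Sum>i=0..n. fps_nth (powr_fps k c a) i * b (n - i) r)"
      unfolding fps_mult_nth b_def mult.assoc sum_distrib_left
      by (intro sum.cong) simp_all
    finally show ?thesis .
  qed
  have "((\<lambda>t. \<Sum>r. b n r * t ^ r) has_real_derivative (\<Sum>r. diffs (b n) r * t ^ r)) (at t)"
    by (rule termdiffs_strong_converges_everywhere) (rule sums_summable[OF sums])
  also have "(\<lambda>t. \<Sum>r. b n r * t ^ r) = stable_weight k c a n"
    using sums by (simp add: sums_iff)
  also have "(\<lambda>r. ?A * (\<Sum>i=0..n. fps_nth (powr_fps k c a) i * (b (n - i) r * t ^ r))) sums
               (?A * (\<Sum>i=0..n. fps_nth (powr_fps k c a) i * stable_weight k c a (n - i) t))"
    by (intro sums_mult sums_sum sums)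
  then have "(\<Sum>r. diffs (b n) r * t ^ r) =
      ?A * (\<Sum>i=0..n. fps_nth (powr_fps k c a) i * stable_weight k c a (n - i) t)"
    by (simp add: diffs sums_iff sum_distrib_right mult.assoc)
  finally show ?thesis
    by (simp add: fps_mult_nth)
qed

text \<open>At t = 0 only the term r = 0 survives, and it carries (\<psi>/\<mu>)^0 = 1.\<close>

lemma stable_weight_0:
  assumes "0 < a"
  shows "stable_weight k c a n 0 = (if n = 0 then 1 else 0)"
proof -
  have "stable_weight k c a n 0 = fps_nth (powr_fps k c 0) n"
    using stable_weight_sums[OF assms, where k = k and c = c and n = n and t = 0]
      powser_sums_zero[of "\<lambda>r. (- ((\<Sum>j=1..k. c j) powr a)) ^ r / fact r * fps_nth (powr_fps k c (a * real r)) n"]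
    by (auto dest: sums_unique2)
  then show ?thesis
    by (simp add: powr_fps_def)
qed

lemma sum_Theta_stable_weight:
  "(\<Sum>m\<in>Theta n. \<Prod>i\<in>UNIV. stable_weight k (c i) (a i) (m i) (t i)) =
   fps_nth (\<Prod>i\<in>UNIV. Abs_fps (\<lambda>m. stable_weight k (c i) (a i) m (t i))) n"
  by (simp add: fps_nth_prod Theta_eq_weak_compositions)

text \<open>Only the i-th factor of the generating function depends on \<open>s\<close>. The
  operator is multiplication by a power series, so its action on that factor is its action on the
  whole product.\<close>

lemma sum_Theta_stable_weight_has_derivative:
  fixes a t :: "'d::finite \<Rightarrow> real" and c :: "'d \<Rightarrow> nat \<Rightarrow> real" and k :: nat
  defines "p \<equiv> \<lambda>n t. \<Sum>m\<in>Theta n. \<Prod>i\<in>UNIV. stable_weight k (c i) (a i) (m i) (t i)"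
  assumes "0 < a i"
  shows "((\<lambda>s. p n (t(i := s))) has_real_derivative
           - frac_diff_op k (c i) (a i) (\<lambda>m. p m t) n) (at (t i))"
proof -
  let ?F = "\<lambda>l s. Abs_fps (\<lambda>m. stable_weight k (c l) (a l) m s)"
  let ?A = "- ((\<Sum>j=1..k. c i j) powr a i)" and ?U = "powr_fps k (c i) (a i)"
  define G where "G = (\<Prod>l\<in>UNIV - {i}. ?F l (t l))"
  have p: "Abs_fps (\<lambda>m. p m (t(i := s))) = ?F i s * G" for s
  proof -
    have "Abs_fps (\<lambda>m. p m (t(i := s))) = (\<Prod>l\<in>UNIV. ?F l ((t(i := s)) l))"
      by (simp only: fps_eq_iff p_def sum_Theta_stable_weight fps_nth_Abs_fps) simp
    also have "\<dots> = ?F i s * (\<Prod>l\<in>UNIV - {i}. ?F l ((t(i := s)) l))"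
      by (subst prod.remove[of _ i]) auto
    also have "(\<Prod>l\<in>UNIV - {i}. ?F l ((t(i := s)) l)) = G"
      unfolding G_def by (intro prod.cong) auto
    finally show ?thesis .
  qed
  have "((\<lambda>s. \<Sum>j=0..n. stable_weight k (c i) (a i) j s * fps_nth G (n - j)) has_real_derivative
          (\<Sum>j=0..n. ?A * fps_nth (?U * ?F i (t i)) j * fps_nth G (n - j))) (at (t i))"
    by (intro DERIV_sum DERIV_cmult_right stable_weight_has_derivative assms)
  also have "(\<lambda>s. \<Sum>j=0..n. stable_weight k (c i) (a i) j s * fps_nth G (n - j)) = (\<lambda>s. p n (t(i := s)))"
  proof
    fix s
    show "(\<Sum>j=0..n. stable_weight k (c i) (a i) j s * fps_nth G (n - j)) = p n (t(i := s))"
      using arg_cong[OF p[of s], of "\<lambda>F. fps_nth F n"] by (simp add: fps_mult_nth)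
  qed
  also have "(\<Sum>j=0..n. ?A * fps_nth (?U * ?F i (t i)) j * fps_nth G (n - j)) =
      ?A * fps_nth (?U * Abs_fps (\<lambda>m. p m t)) n"
    using p[of "t i"] by (simp add: fps_mult_nth sum_distrib_left mult.assoc flip: mult.assoc)
  finally show ?thesis
    by (simp only: frac_diff_op_eq_fps_nth mult_minus_left)
qed

section \<open>Subordination of monotone processes\<close>

lemma borel_measurable_vecI:
  fixes f :: "'a \<Rightarrow> real ^ 'd"
  assumes "\<And>i. (\<lambda>x. f x $ i) \<in> borel_measurable M"
  shows "f \<in> borel_measurable M"
  using assms by (subst borel_measurable_euclidean_space) (auto simp: Basis_vec_def inner_axis)

text \<open>The countably many exceptional sets fit into one null set \<open>Z\<close>. Removing
  \<open>Z\<close> from the union of the \<open>A j\<close> and adding it to the intersection of the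
  \<open>B j\<close> encloses \<open>S\<close> between two events of probability
  \<open>L\<close>.\<close>

lemma (in prob_space) completion_sandwich:
  assumes A: "\<And>j::nat. A j \<in> events" and B: "\<And>j::nat. B j \<in> events" and S: "S \<subseteq> space M"
    and AS: "\<And>j. AE \<omega> in M. \<omega> \<in> A j \<longrightarrow> \<omega> \<in> S" and SB: "\<And>j. AE \<omega> in M. \<omega> \<in> S \<longrightarrow> \<omega> \<in> B j"
    and limA: "(\<lambda>j. prob (A j)) \<longlonglongrightarrow> L" and limB: "(\<lambda>j. prob (B j)) \<longlonglongrightarrow> L"
  shows "S \<in> sets (completion M)" and "measure (completion M) S = L"
proof -
  interpret C: prob_space "completion M" by (rule prob_space_completion)
  have "AE \<omega> in M. \<forall>j. (\<omega> \<in> A j \<longrightarrow> \<omega> \<in> S) \<and> (\<omega> \<in> S \<longrightarrow> \<omega> \<in> B j)"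
    using AS SB by (simp add: AE_all_countable)
  then obtain Z
    where Z': "\<forall>\<omega>\<in>space M - Z. \<forall>j. (\<omega> \<in> A j \<longrightarrow> \<omega> \<in> S) \<and> (\<omega> \<in> S \<longrightarrow> \<omega> \<in> B j)"
      and Z: "Z \<in> null_sets M"
    by (rule AE_E3) blast
  define A' where "A' = (\<Union>j. A j) - Z"
  define B' where "B' = (\<Inter>j. B j) \<union> Z"
  have [measurable]: "A' \<in> events" "B' \<in> events"
    using A B Z by (auto simp: A'_def B'_def)
  have sub: "A' \<subseteq> S" "S \<subseteq> B'"
    using Z' S sets.sets_into_space[OF A] by (auto simp: A'_def B'_def)
  have "prob (A j) \<le> prob A'" for j
  proof -
    have "prob A' = prob (\<Union>j. A j)"
      unfolding A'_def using A Z by (intro measure_Diff_null_set) auto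
    then show ?thesis
      using A by (auto intro!: finite_measure_mono)
  qed
  then have "L \<le> prob A'"
    by (intro LIMSEQ_le_const2[OF limA]) auto
  moreover have "prob B' \<le> prob (B j)" for j
  proof -
    have "prob B' = prob (\<Inter>j. B j)"
      unfolding B'_def using B Z by (intro measure_Un_null_set) auto
    then show ?thesis
      using B by (auto intro!: finite_measure_mono)
  qed
  then have "prob B' \<le> L"
    by (intro LIMSEQ_le_const[OF limB]) auto
  moreover have "prob A' \<le> prob B'"
    using sub by (intro finite_measure_mono) auto
  ultimately have L: "prob A' = L" "prob B' = L" by auto
  then have "prob (B' - A') = 0"
    using sub by (subst finite_measure_Diff) auto
  then have "B' - A' \<in> null_sets M"
    by (intro null_setsI) (auto simp: emeasure_eq_measure)
  then show *: "S \<in> sets (completion M)"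
    by (rule sets_completionI[where S = A' and N = "S - A'", rotated 2]) (use sub in auto)
  show "measure (completion M) S = L"
    using C.finite_measure_mono[OF sub(1) *] C.finite_measure_mono[OF sub(2)] L by simp
qed

text \<open>Coordinatewise rounding to multiples of 1/(m + 1): \<open>b = 0\<close> rounds down and
  \<open>b = 1\<close> goes to the next multiple strictly above. Clipping at 0 keeps the values in
  the orthant for every \<open>x\<close>.\<close>

definition grid :: "int \<Rightarrow> nat \<Rightarrow> real ^ 'd \<Rightarrow> real ^ 'd" where
  "grid b m x = (\<chi> i. max 0 (real_of_int (\<lfloor>real (Suc m) * x $ i\<rfloor> + b) / real (Suc m)))"

lemma grid_nonneg: "0 \<le> grid b m x"
  by (simp add: grid_def less_eq_vec_def del: of_nat_Suc)

lemma grid_measurable [measurable]: "grid b m \<in> borel_measurable borel"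
  by (intro borel_measurable_vecI) (simp add: grid_def del: of_nat_Suc)

lemma countable_range_grid: "countable (range (grid b m :: real ^ 'd \<Rightarrow> real ^ 'd))"
proof (rule countable_subset)
  show "range (grid b m) \<subseteq> range (\<lambda>h :: int ^ 'd. \<chi> i. max 0 (real_of_int (h $ i) / real (Suc m)))"
  proof (intro image_subsetI)
    fix x :: "real ^ 'd"
    show "grid b m x \<in> range (\<lambda>h :: int ^ 'd. \<chi> i. max 0 (real_of_int (h $ i) / real (Suc m)))"
      by (rule image_eqI[of _ _ "\<chi> i. \<lfloor>real (Suc m) * x $ i\<rfloor> + b"]) (simp_all add: grid_def)
  qed
qed simp

lemma grid_0_le: "0 \<le> x \<Longrightarrow> grid 0 m x \<le> x"
proof -
  have "real_of_int \<lfloor>real (Suc m) * x $ i\<rfloor> / real (Suc m) \<le> x $ i" for i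
    by (simp add: divide_le_eq mult.commute del: of_nat_Suc)
  moreover assume "0 \<le> x"
  ultimately show ?thesis
    by (simp add: less_eq_vec_def grid_def del: of_nat_Suc)
qed

lemma grid_1_ge: "x \<le> grid 1 m x"
proof -
  have "x $ i \<le> (real_of_int \<lfloor>real (Suc m) * x $ i\<rfloor> + 1) / real (Suc m)" for i
  proof -
    have "real (Suc m) * x $ i \<le> real_of_int \<lfloor>real (Suc m) * x $ i\<rfloor> + 1"
      by linarith
    then show ?thesis
      by (simp add: le_divide_eq mult.commute del: of_nat_Suc)
  qed
  then show ?thesis
    by (simp add: less_eq_vec_def grid_def le_max_iff_disj del: of_nat_Suc)
qed

lemma grid_tendsto:
  fixes x :: "real ^ 'd"
  assumes "0 \<le> x" "b \<in> {0, 1}"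
  shows "(\<lambda>m. grid b m x) \<longlonglongrightarrow> x"
proof (rule vec_tendstoI)
  fix i
  have x: "0 \<le> x $ i" using assms by (simp add: less_eq_vec_def)
  have bounds: "x $ i - 1 / real (Suc m) \<le> grid b m x $ i \<and> grid b m x $ i \<le> x $ i + 1 / real (Suc m)" for m
  proof -
    let ?f = "real_of_int (\<lfloor>real (Suc m) * x $ i\<rfloor> + b)"
    have "real (Suc m) * x $ i - 1 \<le> ?f" "?f \<le> real (Suc m) * x $ i + 1"
      using assms(2) by (auto; linarith)+
    then have "(real (Suc m) * x $ i - 1) / real (Suc m) \<le> ?f / real (Suc m)"
      "?f / real (Suc m) \<le> (real (Suc m) * x $ i + 1) / real (Suc m)"
      by (intro divide_right_mono; simp)+
    then have "x $ i - 1 / real (Suc m) \<le> ?f / real (Suc m)" "?f / real (Suc m) \<le> x $ i + 1 / real (Suc m)"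
      by (simp_all add: diff_divide_distrib add_divide_distrib)
    then show ?thesis
      using x by (auto simp: grid_def)
  qed
  have "(\<lambda>m. x $ i - 1 / real (Suc m)) \<longlonglongrightarrow> x $ i - 0" "(\<lambda>m. x $ i + 1 / real (Suc m)) \<longlonglongrightarrow> x $ i + 0"
    by (intro tendsto_intros LIMSEQ_Suc[OF lim_1_over_n])+
  then have lim: "(\<lambda>m. x $ i - 1 / real (Suc m)) \<longlonglongrightarrow> x $ i" "(\<lambda>m. x $ i + 1 / real (Suc m)) \<longlonglongrightarrow> x $ i"
    by (simp_all only: diff_zero add_0_right)
  show "(\<lambda>m. grid b m x $ i) \<longlonglongrightarrow> x $ i"
    by (rule tendsto_sandwich[OF always_eventually always_eventually lim]) (use bounds in blast)+
qed

text \<open>Tail events are used because monotonicity of \<open>N\<close> orders them: the tail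
  event at X lies between those at the two roundings of X. Each rounding takes countably many
  values, so independence computes its probability, and both converge to the same
  expectation.\<close>

lemma (in prob_space)
  fixes N :: "real ^ 'd \<Rightarrow> 'a \<Rightarrow> int" and X :: "'a \<Rightarrow> real ^ 'd"
  assumes N [measurable]: "\<And>s. 0 \<le> s \<Longrightarrow> N s \<in> measurable M (count_space UNIV)"
    and mono: "\<And>\<omega> s t. \<omega> \<in> space M \<Longrightarrow> 0 \<le> s \<Longrightarrow> s \<le> t \<Longrightarrow> N s \<omega> \<le> N t \<omega>"
    and X [measurable]: "X \<in> borel_measurable M" and X_nonneg: "AE \<omega> in M. 0 \<le> X \<omega>"
    and indep: "\<And>A s. A \<in> sets borel \<Longrightarrow> 0 \<le> s \<Longrightarrow>
      prob ({\<omega> \<in> space M. X \<omega> \<in> A} \<inter> {\<omega> \<in> space M. m \<le> N s \<omega>}) =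
      prob {\<omega> \<in> space M. X \<omega> \<in> A} * prob {\<omega> \<in> space M. m \<le> N s \<omega>}"
    and G: "\<And>s. 0 \<le> s \<Longrightarrow> prob {\<omega> \<in> space M. m \<le> N s \<omega>} = G s"
    and cont: "continuous_on UNIV G"
  shows subordinated_tail_sets: "{\<omega> \<in> space M. m \<le> N (X \<omega>) \<omega>} \<in> sets (completion M)"
    and subordinated_tail_measure:
      "measure (completion M) {\<omega> \<in> space M. m \<le> N (X \<omega>) \<omega>} = expectation (\<lambda>\<omega>. G (X \<omega>))"
proof -
  have [measurable]: "G \<in> borel_measurable borel"
    by (rule borel_measurable_continuous_onI[OF cont])
  have G_bounds: "0 \<le> G s" "G s \<le> 1" if "0 \<le> s" for s
    using G[OF that, symmetric] by simp_all
  define E where "E = (\<lambda>b j. {\<omega> \<in> space M. m \<le> N (grid b j (X \<omega>)) \<omega>})"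
  have E: "E b j \<in> events \<and> prob (E b j) = expectation (\<lambda>\<omega>. G (grid b j (X \<omega>)))" for b j
  proof -
    let ?I = "range (grid b j :: real ^ 'd \<Rightarrow> _)"
    define F where "F = (\<lambda>c. {\<omega> \<in> space M. X \<omega> \<in> grid b j -` {c}} \<inter> {\<omega> \<in> space M. m \<le> N c \<omega>})"
    have I: "countable ?I" by (rule countable_range_grid)
    have nonneg: "0 \<le> c" if "c \<in> ?I" for c
      using that grid_nonneg by auto
    have vim: "grid b j -` {c} \<in> sets borel" for c
      using measurable_sets[OF grid_measurable, of "{c}"] by simp
    have F [measurable]: "F c \<in> events" if "c \<in> ?I" for c
      using vim N[OF nonneg[OF that]] unfolding F_def by measurable
    have E_eq: "E b j = (\<Union>c\<in>?I. F c)"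
      by (auto simp: E_def F_def)
    have meas: "E b j \<in> events"
      unfolding E_eq using I F by (intro sets.countable_UN') auto
    define V where "V = (\<lambda>c. {\<omega> \<in> space M. X \<omega> \<in> grid b j -` {c}})"
    have V [measurable]: "V c \<in> events" for c
      using vim unfolding V_def by measurable
    \<comment> \<open>Splitting by the grid value c gives the sum of G(c) P(grid X = c); exchanging
      sum and integral turns it into the expectation of G(grid X).\<close>
    have "emeasure M (E b j) = (\<integral>\<^sup>+c. emeasure M (F c) \<partial>count_space ?I)"
      unfolding E_eq by (intro emeasure_UN_countable F I) (auto simp: disjoint_family_on_def F_def)
    also have "\<dots> = (\<integral>\<^sup>+c. (\<integral>\<^sup>+\<omega>. ennreal (G c) * indicator (V c) \<omega> \<partial>M) \<partial>count_space ?I)"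
    proof (rule nn_integral_cong)
      fix c assume "c \<in> space (count_space ?I)"
      then have c: "0 \<le> c" using nonneg by simp
      have "emeasure M (F c) = ennreal (G c * prob (V c))"
        using indep[OF vim c] G[OF c] by (simp add: F_def V_def emeasure_eq_measure mult.commute)
      also have "\<dots> = ennreal (G c) * emeasure M (V c)"
        by (simp only: ennreal_mult'[OF G_bounds(1)[OF c]] emeasure_eq_measure)
      finally show "emeasure M (F c) = (\<integral>\<^sup>+\<omega>. ennreal (G c) * indicator (V c) \<omega> \<partial>M)"
        using V by (simp only: nn_integral_cmult_indicator)
    qed
    also have "\<dots> = (\<integral>\<^sup>+\<omega>. (\<integral>\<^sup>+c. ennreal (G c) * indicator (V c) \<omega> \<partial>count_space ?I) \<partial>M)"
      by (intro nn_integral_count_space_nn_integral[symmetric] I) measurable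
    also have "\<dots> = (\<integral>\<^sup>+\<omega>. ennreal (G (grid b j (X \<omega>))) \<partial>M)"
    proof (rule nn_integral_cong)
      fix \<omega> assume "\<omega> \<in> space M"
      then show "(\<integral>\<^sup>+c. ennreal (G c) * indicator (V c) \<omega> \<partial>count_space ?I) = ennreal (G (grid b j (X \<omega>)))"
        by (subst nn_integral_count_space'[where A = "{grid b j (X \<omega>)}"]) (auto simp: V_def indicator_def)
    qed
    finally have "prob (E b j) = expectation (\<lambda>\<omega>. G (grid b j (X \<omega>)))"
      by (subst integral_eq_nn_integral) (auto simp: measure_def G_bounds grid_nonneg simp del: of_nat_Suc)
    with meas show ?thesis by simp
  qed
  \<comment> \<open>Continuity of \<open>G\<close> gives pointwise convergence, and probabilities
    are bounded by 1, so dominated convergence applies to both roundings.\<close>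
  have lim: "(\<lambda>j. prob (E b j)) \<longlonglongrightarrow> expectation (\<lambda>\<omega>. G (X \<omega>))" if "b \<in> {0, 1}" for b
  proof -
    have "(\<lambda>j. expectation (\<lambda>\<omega>. G (grid b j (X \<omega>)))) \<longlonglongrightarrow> expectation (\<lambda>\<omega>. G (X \<omega>))"
    proof (rule integral_dominated_convergence[where w = "\<lambda>_. 1"])
      show "AE \<omega> in M. (\<lambda>j. G (grid b j (X \<omega>))) \<longlonglongrightarrow> G (X \<omega>)"
        using X_nonneg
      proof eventually_elim
        case (elim \<omega>)
        have "isCont G (X \<omega>)"
          using cont by (simp add: continuous_on_eq_continuous_at)
        then show ?case
          by (rule isCont_tendsto_compose) (rule grid_tendsto[OF elim that])
      qed
    qed (auto simp: G_bounds grid_nonneg)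
    then show ?thesis using E by simp
  qed
  have lower: "AE \<omega> in M. \<omega> \<in> E 0 j \<longrightarrow> \<omega> \<in> {\<omega> \<in> space M. m \<le> N (X \<omega>) \<omega>}" for j
    using X_nonneg
  proof eventually_elim
    case (elim \<omega>)
    show ?case
    proof
      assume *: "\<omega> \<in> E 0 j"
      then have "N (grid 0 j (X \<omega>)) \<omega> \<le> N (X \<omega>) \<omega>"
        by (intro mono grid_nonneg grid_0_le elim) (simp add: E_def)
      with * show "\<omega> \<in> {\<omega> \<in> space M. m \<le> N (X \<omega>) \<omega>}"
        by (simp add: E_def)
    qed
  qed
  have upper: "AE \<omega> in M. \<omega> \<in> {\<omega> \<in> space M. m \<le> N (X \<omega>) \<omega>} \<longrightarrow> \<omega> \<in> E 1 j" for j
    using X_nonneg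
  proof eventually_elim
    case (elim \<omega>)
    show ?case
    proof
      assume *: "\<omega> \<in> {\<omega> \<in> space M. m \<le> N (X \<omega>) \<omega>}"
      then have "N (X \<omega>) \<omega> \<le> N (grid 1 j (X \<omega>)) \<omega>"
        by (intro mono grid_1_ge elim) simp
      with * show "\<omega> \<in> E 1 j"
        by (simp add: E_def)
    qed
  qed
  show "{\<omega> \<in> space M. m \<le> N (X \<omega>) \<omega>} \<in> sets (completion M)"
    by (rule completion_sandwich(1)[OF _ _ _ lower upper lim lim]) (use E in auto)
  show "measure (completion M) {\<omega> \<in> space M. m \<le> N (X \<omega>) \<omega>} = expectation (\<lambda>\<omega>. G (X \<omega>))"
    by (rule completion_sandwich(2)[OF _ _ _ lower upper lim lim]) (use E in auto)
qed

text \<open>Brings independence of whole processes down to events at single times, as pullbacks of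
  coordinate projections.\<close>

lemma (in prob_space) process_events_imp_events:
  assumes "t \<in> T" "A \<in> sets S" "\<And>s \<omega>. s \<in> T \<Longrightarrow> \<omega> \<in> space M \<Longrightarrow> X s \<omega> \<in> space S"
  shows "{\<omega> \<in> space M. X t \<omega> \<in> A} \<in> process_events T S X"
proof -
  have "(\<lambda>f. f t) -` A \<inter> space (PiM T (\<lambda>_. S)) \<in> sets (PiM T (\<lambda>_. S))"
    using assms by measurable
  then have "(\<lambda>\<omega>. \<lambda>t\<in>T. X t \<omega>) -` ((\<lambda>f. f t) -` A \<inter> space (PiM T (\<lambda>_. S))) \<inter> space M \<in>
      sets (vimage_algebra (space M) (\<lambda>\<omega>. \<lambda>t\<in>T. X t \<omega>) (PiM T (\<lambda>_. S)))"
    by (rule in_vimage_algebra)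
  also have "(\<lambda>\<omega>. \<lambda>t\<in>T. X t \<omega>) -` ((\<lambda>f. f t) -` A \<inter> space (PiM T (\<lambda>_. S))) \<inter> space M =
      {\<omega> \<in> space M. X t \<omega> \<in> A}"
    using assms by (auto simp: space_PiM PiE_iff)
  finally show ?thesis
    unfolding process_events_def .
qed

text \<open>The point probability is a difference of consecutive tails, each known from the sandwich
  argument. Factoring the GCP law over coordinates then lets independence of the \<open>D i\<close>
  turn the expectation of a product into a product of expectations.\<close>

lemma (in prob_space) subordinated_gcp_pmf:
  fixes \<Lambda> :: "nat \<Rightarrow> real ^ 'd" and \<alpha> :: "real ^ 'd"
  assumes N: "multi_GCP k \<Lambda> N" and D: "multi_stable_subordinator \<alpha> D"
    and indep: "indep_set (process_events {0..} (count_space UNIV) N) (process_events {0..} borel (vec_process D))"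
    and pos: "\<And>i. 0 < (\<Sum>j=1..k. \<Lambda> j $ i)" and t: "0 \<le> t"
  shows "subordinated_pmf M N (vec_process D) n t =
    (\<Sum>m\<in>Theta n. \<Prod>i\<in>UNIV. expectation (\<lambda>\<omega>. gcp_weight k (\<lambda>j. \<Lambda> j $ i) (m i) (D i (t $ i) \<omega>)))"
proof -
  interpret C: prob_space "completion M" by (rule prob_space_completion)
  define X where "X = vec_process D t"
  define q where "q = (\<lambda>n s. \<Sum>x\<in>Omega k n. \<Prod>j=1..k. (\<Lambda> j \<bullet> s) ^ x j / fact (x j) * exp (- (\<Lambda> j \<bullet> s)))"
  \<comment> \<open>On the orthant this is the tail probability of \<open>N s\<close>; as a finite
    expression in \<open>s\<close> it is continuous on the whole space.\<close>
  define G where "G = (\<lambda>m s. 1 - (\<Sum>l<m. q l s))"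
  have ti: "0 \<le> t $ i" for i
    using t by (simp add: less_eq_vec_def)
  have stable: "stable_subordinator (\<alpha> $ i) (D i)" for i
    using D by (simp add: multi_stable_subordinator_def)
  have N_meas [measurable]: "N s \<in> measurable M (count_space UNIV)" if "0 \<le> s" for s
    using N that by (simp add: multi_GCP_def multi_counting_process_def)
  have N_path: "0 \<le> N s \<omega>" "s \<le> u \<Longrightarrow> N s \<omega> \<le> N u \<omega>" if "\<omega> \<in> space M" "0 \<le> s" for s u \<omega>
    using N that by (auto simp: multi_GCP_def multi_counting_process_def)
  have N_pmf: "prob {\<omega> \<in> space M. N s \<omega> = int n} = q n s" if "0 \<le> s" for s n
    using N that by (simp add: multi_GCP_def q_def)
  have D_meas [measurable]: "D i (t $ i) \<in> borel_measurable M" for i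
    by (rule stable_subordinator_measurable[OF stable ti])
  have X_meas [measurable]: "X \<in> borel_measurable M"
    by (rule borel_measurable_vecI) (simp add: X_def vec_process_def)
  have X_nonneg: "AE \<omega> in M. 0 \<le> X \<omega>"
  proof -
    have "AE \<omega> in M. \<forall>i\<in>UNIV. 0 \<le> D i (t $ i) \<omega>"
      by (intro AE_finite_allI stable_subordinator_nonneg[OF stable ti]) simp
    then show ?thesis
      by eventually_elim (simp add: X_def vec_process_def less_eq_vec_def)
  qed
  have tail: "prob {\<omega> \<in> space M. int m \<le> N s \<omega>} = G m s" if s: "0 \<le> s" for m s
  proof -
    note [measurable] = N_meas[OF s]
    have "{\<omega> \<in> space M. int m \<le> N s \<omega>} = space M - (\<Union>l<m. {\<omega> \<in> space M. N s \<omega> = int l})"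
    proof (intro set_eqI iffI)
      fix \<omega> assume \<omega>: "\<omega> \<in> space M - (\<Union>l<m. {\<omega> \<in> space M. N s \<omega> = int l})"
      then obtain l where "N s \<omega> = int l"
        using N_path(1)[OF _ s, of \<omega>] zero_le_imp_eq_int by blast
      with \<omega> show "\<omega> \<in> {\<omega> \<in> space M. int m \<le> N s \<omega>}"
        by (cases "l < m") auto
    qed auto
    also have "prob \<dots> = 1 - prob (\<Union>l<m. {\<omega> \<in> space M. N s \<omega> = int l})"
      by (rule prob_compl) measurable
    also have "prob (\<Union>l<m. {\<omega> \<in> space M. N s \<omega> = int l}) = (\<Sum>l<m. q l s)"
      by (subst finite_measure_finite_Union) (auto simp: disjoint_family_on_def N_pmf[OF s])
    finally show ?thesis
      by (simp add: G_def)
  qed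
  have cont: "continuous_on UNIV (G m)" for m
    unfolding G_def q_def by (intro continuous_intros) auto
  have ind: "prob ({\<omega> \<in> space M. X \<omega> \<in> A} \<inter> {\<omega> \<in> space M. m \<le> N s \<omega>}) =
      prob {\<omega> \<in> space M. X \<omega> \<in> A} * prob {\<omega> \<in> space M. m \<le> N s \<omega>}"
    if "A \<in> sets borel" "0 \<le> s" for A m s
  proof -
    have "{\<omega> \<in> space M. N s \<omega> \<in> {m..}} \<in> process_events {0..} (count_space UNIV) N"
      using that by (intro process_events_imp_events) auto
    moreover have "{\<omega> \<in> space M. vec_process D t \<omega> \<in> A} \<in> process_events {0..} borel (vec_process D)"
      using that t by (intro process_events_imp_events) auto
    ultimately show ?thesis
      using indep_setD[OF indep] by (simp add: X_def Int_commute mult.commute)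
  qed
  let ?S = "\<lambda>m. {\<omega> \<in> space M. int m \<le> N (X \<omega>) \<omega>}"
  note S_sets = subordinated_tail_sets[OF N_meas N_path(2) X_meas X_nonneg ind tail cont]
  note S_measure = subordinated_tail_measure[OF N_meas N_path(2) X_meas X_nonneg ind tail cont]
  have G_int: "integrable M (\<lambda>\<omega>. G m (X \<omega>))" for m
  proof (rule integrable_const_bound)
    show "AE \<omega> in M. norm (G m (X \<omega>)) \<le> 1"
      using X_nonneg by eventually_elim (simp flip: tail)
    show "(\<lambda>\<omega>. G m (X \<omega>)) \<in> borel_measurable M"
      using borel_measurable_continuous_onI[OF cont] by measurable
  qed
  have "{\<omega> \<in> space M. N (X \<omega>) \<omega> = int n} = ?S n - ?S (Suc n)"
    by auto
  then have "subordinated_pmf M N (vec_process D) n t = measure (completion M) (?S n - ?S (Suc n))"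
    by (simp add: subordinated_pmf_def X_def)
  also have "\<dots> = measure (completion M) (?S n) - measure (completion M) (?S (Suc n))"
    by (intro C.finite_measure_Diff S_sets) auto
  also have "\<dots> = expectation (\<lambda>\<omega>. G n (X \<omega>)) - expectation (\<lambda>\<omega>. G (Suc n) (X \<omega>))"
    by (simp only: S_measure)
  also have "\<dots> = expectation (\<lambda>\<omega>. G n (X \<omega>) - G (Suc n) (X \<omega>))"
    by (intro Bochner_Integration.integral_diff[symmetric] G_int)
  \<comment> \<open>Consecutive tails telescope to \<open>q n\<close>, which then factors over the
    coordinates.\<close>
  also have "\<dots> = expectation (\<lambda>\<omega>. \<Sum>m\<in>Theta n. \<Prod>i\<in>UNIV. gcp_weight k (\<lambda>j. \<Lambda> j $ i) (m i) (D i (t $ i) \<omega>))"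
    unfolding G_def q_def gcp_pmf_eq_Theta X_def vec_process_def by simp
  also have "\<dots> = (\<Sum>m\<in>Theta n. \<Prod>i\<in>UNIV. expectation (\<lambda>\<omega>. gcp_weight k (\<lambda>j. \<Lambda> j $ i) (m i) (D i (t $ i) \<omega>)))"
  proof -
    have ind_w: "indep_vars (\<lambda>_. borel) (\<lambda>i \<omega>. gcp_weight k (\<lambda>j. \<Lambda> j $ i) (m i) (D i (t $ i) \<omega>)) UNIV" for m
    proof -
      have "indep_vars (\<lambda>_. PiM {0..} (\<lambda>_. borel)) (\<lambda>i \<omega>. \<lambda>s\<in>{0..}. D i s \<omega>) UNIV"
        using D by (simp add: multi_stable_subordinator_def)
      moreover have "(\<lambda>f. gcp_weight k (\<lambda>j. \<Lambda> j $ i) (m i) (f (t $ i))) \<in> borel_measurable (PiM {0..} (\<lambda>_. borel))" for i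
      proof -
        have [measurable]: "(\<lambda>f. f (t $ i)) \<in> borel_measurable (PiM {0..} (\<lambda>_. borel :: real measure))"
          by (rule measurable_component_singleton) (simp add: ti)
        show ?thesis
          unfolding gcp_weight_eq_powers by measurable
      qed
      ultimately have "indep_vars (\<lambda>_. borel)
          (\<lambda>i \<omega>. gcp_weight k (\<lambda>j. \<Lambda> j $ i) (m i) ((\<lambda>s\<in>{0..}. D i s \<omega>) (t $ i))) UNIV"
        by (rule indep_vars_compose2[where Y = "\<lambda>i f. gcp_weight k (\<lambda>j. \<Lambda> j $ i) (m i) (f (t $ i))"])
      then show ?thesis
        using ti by simp
    qed
    note int_w = integrable_gcp_weight[OF stable ti pos]
    show ?thesis
      by (subst Bochner_Integration.integral_sum)
         (simp_all only: indep_vars_lebesgue_integral[OF finite ind_w int_w] indep_vars_integrable[OF finite ind_w int_w])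
  qed
  finally show ?thesis .
qed

section \<open>The distribution, its differential equations and the initial values\<close>

theorem theorem3p1:
  fixes P :: "'w measure"
    and k :: nat
    and \<Lambda> :: "nat \<Rightarrow> real ^ 'd"
    and \<alpha> :: "real ^ 'd"
    and N :: "real ^ 'd \<Rightarrow> 'w \<Rightarrow> int"
    and D :: "'d \<Rightarrow> real \<Rightarrow> 'w \<Rightarrow> real"
    and \<mu> :: "'d \<Rightarrow> real"
    and p :: "nat \<Rightarrow> real ^ 'd \<Rightarrow> real"
  assumes "prob_space P"
    and "k \<ge> 1"
    and "\<forall>j\<in>{1..k}. 0 \<prec> \<Lambda> j"
    and "\<forall>i. 0 < \<alpha> $ i \<and> \<alpha> $ i < 1"
    and "prob_space.multi_GCP P k \<Lambda> N"
    and "prob_space.multi_stable_subordinator P \<alpha> D"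
    and "prob_space.indep_set P
           (prob_space.process_events P {0..} (count_space UNIV) N)
           (prob_space.process_events P {0..} borel (vec_process D))"
    and mu: "\<And>i. \<mu> i = (\<Sum>j=1..k. \<Lambda> j $ i)"
    and p: "p = subordinated_pmf P N (vec_process D)"
  shows
    "(\<forall>n. \<forall>t\<ge>0.
        (\<forall>m\<in>Theta n. \<forall>i. \<forall>x\<in>Omega k (m i).
           summable (series_term (\<alpha> $ i) (\<mu> i) (t $ i) (\<Sum>j=1..k. x j))) \<and>
        p n t =
          (\<Sum>m\<in>Theta n. \<Prod>i\<in>UNIV. \<Sum>x\<in>Omega k (m i).
             (\<Prod>j=1..k. (- (\<Lambda> j $ i / \<mu> i)) ^ x j * (1 / fact (x j))) *
             (\<Sum>r. series_term (\<alpha> $ i) (\<mu> i) (t $ i) (\<Sum>j=1..k. x j) r))) \<and>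
     (\<forall>i n. \<forall>t\<ge>0.
        ((\<lambda>s. p n (\<chi> l. if l = i then s else t $ l)) has_real_derivative
           - frac_diff_op k (\<lambda>j. \<Lambda> j $ i) (\<alpha> $ i) (\<lambda>m. p m t) n)
          (at (t $ i) within {0..})) \<and>
     p 0 0 = 1 \<and> (\<forall>n\<ge>1. p n 0 = 0)"
proof -
  interpret prob_space P by fact
  let ?c = "\<lambda>i j. \<Lambda> j $ i"
  have \<alpha>: "0 < \<alpha> $ i" for i
    using assms(4) by simp
  have pos: "0 < (\<Sum>j=1..k. \<Lambda> j $ i)" for i
    using assms(2,3) by (intro sum_pos) (auto simp: prec_def)
  have stable: "stable_subordinator (\<alpha> $ i) (D i)" for i
    using assms(6) by (simp add: multi_stable_subordinator_def)
  have ti: "0 \<le> t $ i" if "0 \<le> t" for t :: "real ^ 'd" and i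
    using that by (simp add: less_eq_vec_def)
  note pmf = subordinated_gcp_pmf[OF assms(5-7) pos, folded p]
  \<comment> \<open>An extension of \<open>p\<close> to all real times, so that a two-sided
    derivative is available even at \<open>t $ i = 0\<close>.\<close>
  define w where "w = (\<lambda>n (t :: 'd \<Rightarrow> real). \<Sum>m\<in>Theta n. \<Prod>i\<in>UNIV. stable_weight k (?c i) (\<alpha> $ i) (m i) (t i))"
  have p_w: "p n t = w n (($) t)" if "0 \<le> t" for n t
    by (simp only: pmf[OF that] w_def expectation_gcp_weight[OF stable ti[OF that] pos])
  have formula: "p n t =
      (\<Sum>m\<in>Theta n. \<Prod>i\<in>UNIV. \<Sum>x\<in>Omega k (m i).
         (\<Prod>j=1..k. (- (\<Lambda> j $ i / \<mu> i)) ^ x j * (1 / fact (x j))) *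
         (\<Sum>r. series_term (\<alpha> $ i) (\<mu> i) (t $ i) (\<Sum>j=1..k. x j) r))" if "0 \<le> t" for n t
    by (simp only: pmf[OF that] expectation_gcp_weight_Omega[OF stable ti[OF that] pos] mu)
  have deriv: "((\<lambda>s. p n (\<chi> l. if l = i then s else t $ l)) has_real_derivative
        - frac_diff_op k (?c i) (\<alpha> $ i) (\<lambda>m. p m t) n) (at (t $ i) within {0..})" if t: "0 \<le> t" for i n t
  proof -
    have deriv_w: "((\<lambda>s. w n ((($) t)(i := s))) has_real_derivative
        - frac_diff_op k (?c i) (\<alpha> $ i) (\<lambda>m. w m (($) t)) n) (at (t $ i) within {0..})"
      unfolding w_def
      by (rule has_field_derivative_at_within, rule sum_Theta_stable_weight_has_derivative, rule \<alpha>)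
    have "w n ((($) t)(i := s)) = p n (\<chi> l. if l = i then s else t $ l)" if "s \<in> {0..}" for s
    proof -
      have "0 \<le> (\<chi> l. if l = i then s else t $ l)"
        using that t by (simp add: less_eq_vec_def)
      moreover have "($) (\<chi> l. if l = i then s else t $ l) = (($) t)(i := s)"
        by auto
      ultimately show ?thesis
        by (simp only: p_w)
    qed
    \<comment> \<open>\<open>p\<close> and its extension agree for \<open>s \<ge> 0\<close>, so the
      derivative carries over within \<open>{0..}\<close>; the radius 1 of the neighbourhood is
      arbitrary.\<close>
    from has_field_derivative_transform_within[OF deriv_w zero_less_one _ this] show ?thesis
      unfolding p_w[OF t] using ti[OF t] by simp
  qed
  have init: "p n 0 = (if n = 0 then 1 else 0)" for n
  proof -
    have "p n 0 = fps_nth (\<Prod>i\<in>UNIV. Abs_fps (\<lambda>m. stable_weight k (?c i) (\<alpha> $ i) m 0)) n"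
      by (simp add: p_w w_def sum_Theta_stable_weight)
    \<comment> \<open>At time 0 every coordinate has generating function 1, hence so has the
      product.\<close>
    also have "(\<lambda>i. Abs_fps (\<lambda>m. stable_weight k (?c i) (\<alpha> $ i) m 0)) = (\<lambda>_. 1)"
      by (simp add: fun_eq_iff fps_eq_iff stable_weight_0[OF \<alpha>])
    finally show ?thesis by simp
  qed
  show ?thesis
    using summable_series_term[OF \<alpha>] formula deriv init by simp
qed

end
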